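(* Let $r>s\ge1$, $\upsilon\ge1$, $p\ge1$ be integers with $\gcd(r,s)=1=\gcd(\upsilon,p)$, and let $\mathbb F$ be a field of characteristic $0$ or of characteristic prime to $s$. Let $\mathcal C=\mathcal C_p\subset\mathcal A=\mathbb F[[x,y]]$ be the lift of the conductor of the ring $\mathcal R=\mathbb F[[\,x=z^{\upsilon r}+z^{\upsilon r+p},\ y=z^{\upsilon s}\,]]$, and let $\lambda=\lambda(p)$ be the Young diagram of the monomial ideal $\mathcal C^0$ of leading terms of $\mathcal C$. (i) If $p=1$ or $\upsilon=1$, then $\mathcal C$ is a monomial ideal. It is $\mathcal C=I_\lambda$, where $\lambda$ is formed by the boxes above the diagonal from $(i=\upsilon s,\,j=0)$ to $(i=0,\,j=\upsilon r)$ in the rectangle $\upsilon s\times\upsilon r$ (with $\upsilon s$ rows and $\upsilon r$ columns), including the boxes that touch the diagonal. The total number of such boxes is $\delta$. The first generator of $I_\lambda$ is $x^{\upsilon s-1}$ and the last one is $y^{\lfloor(\upsilon s-1)r/s\rfloor}$. The rank $\varrho(I_\lambda)$, which is the number of outer corners of $\lambda$, equals $\upsilon s$, the multiplicity of the singularity with ring $\mathcal R$. (ii) For every $p\ge1$ the following are outer corners of $\lambda$: $$\bigl(i_b,j_b\bigr)=\Bigl(\upsilon s-1-b,\ \Bigl\lfloor\frac{rb}{s}\Bigr\rfloor\Bigr),\qquad 0\le b\le s-1.$$ The corresponding generators of $\mathcal C$ are $$f_{b+1}=x^{\,s-b-1}\,y^{\,j_b}\,(x^{s}-y^{r})^{\upsilon-1},\qquad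 0\le b\le s-1,$$ modulo higher generators of $\mathcal C$. The ends (in $j$) of the other rows of $\lambda(p)$, those with row index $0\le i\le(\upsilon-1)s-1$, tend to infinity as $p\to\infty$.
   Context: $\mathcal R\subset\mathbb F[[z]]$; the conductor of $\mathcal R$ is the largest ideal of $\mathbb F[[z]]$ contained in $\mathcal R$. It is $(z^{2\delta})$, where $\delta=\dim_{\mathbb F}\mathbb F[[z]]/\mathcal R$ and $2\delta=(\upsilon rs+p-1)(\upsilon-1)+\upsilon(r-1)(s-1)$. Its lift $\mathcal C$ is its full preimage under the surjection $\mathcal A\to\mathcal R$ ($x,y$ are free variables in $\mathcal A$). The multiplicity of the singularity is $\dim_{\mathbb F}\mathbb F[[z]]/\mathfrak m_{\mathcal R}\mathbb F[[z]]$, where $\mathfrak m_{\mathcal R}$ is the maximal ideal of $\mathcal R$. Monomials in $x,y$ are ordered by $1\prec x\prec y$ with $x^m\prec y$ for all $m\ge0$ (first by the power of $y$, then by the power of $x$). The leading term of $f\in\mathcal A$ is its smallest monomial; $\mathcal C^0$ is the ideal generated by the leading terms of elements of $\mathcal C$, and $\mathcal C^0=I_\lambda$, where $I_\lambda$ is spanned by $x^iy^j$ with $(i,j)\notin\lambda$; $i\ge0$ is the row index (counted downward) and $j\ge0$ is the column index of a box. The outer corners of $\lambda$ are the pairs $(i,j)$ for which $x^iy^j$ is a minimal monomial generator of $I_\lambda$; these generators are ordered from the pure power of $x$ (first) to the pure power of $y$ (last). For an ideal $I\subset\mathcal A$, $\varrho(I)=\dim_{\mathbb F}I/\mathfrak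 m_{\mathcal A}I$ with $\mathfrak m_{\mathcal A}=(x,y)$, the minimal number of generators of $I$. "Higher" refers to the order $\prec$ of leading monomials. *)

theory Defs
  imports "HOL-Computational_Algebra.Computational_Algebra" "HOL.Hull"
begin

section \<open>The power series ring in two free variables\<close>

text \<open>
  \<open>\<bbbF>[[x,y]]\<close> is rendered as \<open>\<bbbF>[[x]][[y]]\<close>, i.e. the type \<open>'a fps fps\<close>: the outer series variable is \<open>y\<close>,
  the inner one is \<open>x\<close>. Exponents are pairs \<open>(i,j)\<close>, standing for \<open>x\<^sup>i y\<^sup>j\<close>; as a box, \<open>i\<close> is
  the row index (downward) and \<open>j\<close> the column index.
\<close>

definition varx :: "'a::field fps fps" where
  "varx = fps_const fps_X"

definition vary :: "'a::field fps fps" where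
  "vary = fps_X"

fun monom_xy :: "nat \<times> nat \<Rightarrow> 'a::field fps fps" where
  "monom_xy (i, j) = varx ^ i * vary ^ j"

fun coeff_xy :: "'a::field fps fps \<Rightarrow> nat \<times> nat \<Rightarrow> 'a" where
  "coeff_xy f (i, j) = f $ j $ i"

text \<open>
  The substitution \<open>f(x,y) \<mapsto> f(X(z),Y(z))\<close>, meaningful when \<open>X\<close> and \<open>Y\<close> have zero constant term:
  then \<open>Y\<^sup>j\<close> with \<open>j > n\<close> does not contribute to the coefficient of \<open>z\<^sup>n\<close>, so the truncated sum is
  the full one.
\<close>

definition subst_xy :: "'a::field fps \<Rightarrow> 'a fps \<Rightarrow> 'a fps fps \<Rightarrow> 'a fps" where
  "subst_xy X Y f = Abs_fps (\<lambda>n. (\<Sum>j\<le>n. (f $ j oo X) * Y ^ j) $ n)"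


section \<open>Ideals and quotient dimensions\<close>

text \<open>Ideals of a subring \<open>R\<close> of an ambient commutative ring (the ambient ring itself is \<open>UNIV\<close>).\<close>

definition ideal_of :: "'r::comm_ring_1 set \<Rightarrow> 'r set \<Rightarrow> bool" where
  "ideal_of R I \<longleftrightarrow> I \<subseteq> R \<and> 0 \<in> I \<and> (\<forall>x\<in>I. \<forall>y\<in>I. x + y \<in> I) \<and> (\<forall>a\<in>R. \<forall>x\<in>I. a * x \<in> I)"

definition ideal_gen :: "'r::comm_ring_1 set \<Rightarrow> 'r set" where
  "ideal_gen S = ideal_of UNIV hull S"

definition ideal_mult :: "'r::comm_ring_1 set \<Rightarrow> 'r set \<Rightarrow> 'r set" where
  "ideal_mult I J = ideal_gen {a * b | a b. a \<in> I \<and> b \<in> J}"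

text \<open>Meaningful for a local subring \<open>R\<close> only, where the maximal ideal is unique.\<close>

definition max_ideal :: "'r::comm_ring_1 set \<Rightarrow> 'r set" where
  "max_ideal R = (THE M. ideal_of R M \<and> M \<noteq> R \<and>
     (\<forall>J. ideal_of R J \<and> M \<subseteq> J \<and> J \<noteq> R \<longrightarrow> J = M))"

text \<open>
  \<open>quot_dim scale V W n\<close>: for subspaces \<open>W \<subseteq> V\<close>, the quotient \<open>V/W\<close> is finite-dimensional of
  dimension \<open>n\<close>, i.e. the classes of some \<open>b 0, \<dots>, b (n-1)\<close> in \<open>V\<close> form a basis of it.
  It is a relation and not a function, so that infinite dimension is not conflated with \<open>0\<close>.
\<close>

definition quot_dim :: "('a::field \<Rightarrow> 'v::ab_group_add \<Rightarrow> 'v) \<Rightarrow> 'v set \<Rightarrow> 'v set \<Rightarrow> nat \<Rightarrow> bool" where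
  "quot_dim scale V W n \<longleftrightarrow>
     (\<exists>b. (\<forall>k<n. b k \<in> V) \<and>
          (\<forall>v\<in>V. \<exists>!c. (\<forall>k\<ge>n. c k = 0) \<and> v - (\<Sum>k<n. scale (c k) (b k)) \<in> W))"

definition scale_z :: "'a::field \<Rightarrow> 'a fps \<Rightarrow> 'a fps" where
  "scale_z c f = fps_const c * f"

definition scale_xy :: "'a::field \<Rightarrow> 'a fps fps \<Rightarrow> 'a fps fps" where
  "scale_xy c f = fps_const (fps_const c) * f"

text \<open>\<open>has_rank I n\<close>: the dimension of \<open>I / \<mm> I\<close> with \<open>\<mm> = (x,y)\<close> is \<open>n\<close>.\<close>

definition has_rank :: "'a::field fps fps set \<Rightarrow> nat \<Rightarrow> bool" where
  "has_rank I n \<longleftrightarrow> quot_dim scale_xy I (ideal_mult (ideal_gen {varx, vary}) I) n"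


section \<open>Leading terms, monomial ideals and diagrams\<close>

text \<open>The order on monomials: first by the power of \<open>y\<close>, then by the power of \<open>x\<close>.\<close>

fun mon_less :: "nat \<times> nat \<Rightarrow> nat \<times> nat \<Rightarrow> bool" where
  "mon_less (i, j) (i', j') \<longleftrightarrow> j < j' \<or> (j = j' \<and> i < i')"

text \<open>The leading monomial is the \<^emph>\<open>smallest\<close> one; the zero series has none.\<close>

definition has_leading :: "'a::field fps fps \<Rightarrow> nat \<times> nat \<Rightarrow> bool" where
  "has_leading f m \<longleftrightarrow> coeff_xy f m \<noteq> 0 \<and> (\<forall>m'. coeff_xy f m' \<noteq> 0 \<longrightarrow> m' = m \<or> mon_less m m')"

definition leading_ideal :: "'a::field fps fps set \<Rightarrow> 'a fps fps set" where
  "leading_ideal I = ideal_gen {monom_xy m | m. \<exists>f\<in>I. has_leading f m}"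

definition monomial_ideal :: "'a::field fps fps set \<Rightarrow> bool" where
  "monomial_ideal I \<longleftrightarrow> (\<exists>S. I = ideal_gen (monom_xy ` S))"

text \<open>\<open>I\<^sub>L\<close> for a diagram \<open>L\<close>; \<open>spanned\<close> is understood for power series, i.e. with infinite sums.\<close>

definition diagram_ideal :: "(nat \<times> nat) set \<Rightarrow> 'a::field fps fps set" where
  "diagram_ideal L = {f. \<forall>m. coeff_xy f m \<noteq> 0 \<longrightarrow> m \<notin> L}"

definition leading_diagram :: "'a::field fps fps set \<Rightarrow> (nat \<times> nat) set" where
  "leading_diagram I = {m. monom_xy m \<notin> leading_ideal I}"

text \<open>Exponents of the minimal (under divisibility) monomials outside \<open>L\<close>.\<close>

definition outer_corners :: "(nat \<times> nat) set \<Rightarrow> (nat \<times> nat) set" where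
  "outer_corners L = {(i, j). (i, j) \<notin> L \<and>
     (\<forall>i' j'. (i', j') \<notin> L \<and> i' \<le> i \<and> j' \<le> j \<longrightarrow> i' = i \<and> j' = j)}"

text \<open>Corners sorted from the pure power of \<open>x\<close> to the pure power of \<open>y\<close>, i.e. by increasing \<open>j\<close>.\<close>

definition corner_list :: "(nat \<times> nat) set \<Rightarrow> (nat \<times> nat) list" where
  "corner_list L = sorted_key_list_of_set snd (outer_corners L)"

text \<open>
  Rows of a Young diagram are initial segments, so the end of row \<open>i\<close> is at column coordinate
  \<open>row_length L i\<close>. An infinite row would get the value \<open>0\<close>.
\<close>

definition row_length :: "(nat \<times> nat) set \<Rightarrow> nat \<Rightarrow> nat" where
  "row_length L i = card {j. (i, j) \<in> L}"

text \<open>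
  The boxes of the rectangle with \<open>m\<close> rows and \<open>n\<close> columns above the diagonal from \<open>(m,0)\<close> to
  \<open>(0,n)\<close>. The box \<open>(i,j)\<close> is the closed unit square with upper left vertex \<open>(i,j)\<close>; it may touch the
  diagonal (in its lower right vertex), but must not cross it.
\<close>

definition boxes_above_diagonal :: "nat \<Rightarrow> nat \<Rightarrow> (nat \<times> nat) set" where
  "boxes_above_diagonal m n = {(i, j). i < m \<and> j < n \<and>
     {real i..real i + 1} \<times> {real j..real j + 1} \<subseteq> {(a, b). a / real m + b / real n \<le> 1}}"


section \<open>The ring, its conductor and the lift of the conductor\<close>

definition param_x :: "nat \<Rightarrow> nat \<Rightarrow> nat \<Rightarrow> 'a::field fps" where
  "param_x r \<upsilon> p = fps_X ^ (\<upsilon> * r) + fps_X ^ (\<upsilon> * r + p)"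

definition param_y :: "nat \<Rightarrow> nat \<Rightarrow> 'a::field fps" where
  "param_y s \<upsilon> = fps_X ^ (\<upsilon> * s)"

definition proj_R :: "nat \<Rightarrow> nat \<Rightarrow> nat \<Rightarrow> nat \<Rightarrow> 'a::field fps fps \<Rightarrow> 'a fps" where
  "proj_R r s \<upsilon> p = subst_xy (param_x r \<upsilon> p) (param_y s \<upsilon>)"

definition ring_R :: "nat \<Rightarrow> nat \<Rightarrow> nat \<Rightarrow> nat \<Rightarrow> 'a::field fps set" where
  "ring_R r s \<upsilon> p = range (proj_R r s \<upsilon> p)"

definition conductor :: "'a::field fps set \<Rightarrow> 'a fps set" where
  "conductor R = (GREATEST I. ideal_of UNIV I \<and> I \<subseteq> R)"

definition conductor_lift :: "nat \<Rightarrow> nat \<Rightarrow> nat \<Rightarrow> nat \<Rightarrow> 'a::field fps fps set" where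
  "conductor_lift r s \<upsilon> p = proj_R r s \<upsilon> p -` conductor (ring_R r s \<upsilon> p)"

definition has_delta :: "'a::field fps set \<Rightarrow> nat \<Rightarrow> bool" where
  "has_delta R n \<longleftrightarrow> quot_dim scale_z UNIV R n"

definition has_multiplicity :: "'a::field fps set \<Rightarrow> nat \<Rightarrow> bool" where
  "has_multiplicity R n \<longleftrightarrow> quot_dim scale_z UNIV (ideal_gen (max_ideal R)) n"

end

theory Submission
  imports Defs "HOL-Number_Theory.Cong"
begin

text \<open>
  Put \<open>N = \<upsilon>s\<close> and \<open>e\<^sub>m = x\<^bsup>m mod s\<^esup> (x\<^sup>s - y\<^sup>r)\<^bsup>m div s\<^esup>\<close> for \<open>m < N\<close>. Since \<open>s\<close> is invertible in the field,
  \<open>x\<^sup>s - y\<^sup>r\<close> has order \<open>\<upsilon>rs + p\<close> in \<open>z\<close>, so \<open>e\<^sub>m\<close> has order \<open>v\<^sub>m = \<upsilon>rm + p (m div s)\<close>. These orders are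
  distinct modulo \<open>N\<close>, hence they form the Apery set with respect to \<open>y = z\<^sup>N\<close> of a semigroup with
  conductor \<open>c = v\<^bsub>N-1\<^esub> + 1 - N\<close>, and \<open>\<R>\<close> is the free \<open>\<bbbF>[[y]]\<close>-module on the images of the \<open>e\<^sub>m\<close>.

  Modulo \<open>y\<close>, \<open>e\<^sub>m\<close> is \<open>x\<^sup>m\<close>. So every \<open>f \<in> \<A>\<close> is \<open>\<Sum> a\<^sub>m(y) e\<^sub>m + h x e\<^bsub>N-1\<^esub>\<close>, where \<open>x e\<^bsub>N-1\<^esub>\<close> lies in \<open>\<C>\<close>,
  and \<open>f \<in> \<C>\<close> means that \<open>y\<close> divides \<open>a\<^sub>m\<close> at least \<open>d\<^sub>m\<close> times, with \<open>d\<^sub>m\<close> the least \<open>d\<close> such that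
  \<open>v\<^sub>m + N d \<ge> c\<close>. Therefore \<open>\<C>\<close> is generated by the \<open>y\<^bsup>d\<^sub>m\<^esup> e\<^sub>m\<close> and \<open>\<lambda>\<close> has rows of lengths \<open>d\<^sub>m\<close>, which
  decrease strictly; the symmetry \<open>v\<^sub>m + v\<^bsub>N-1-m\<^esub> = v\<^bsub>N-1\<^esub>\<close> gives \<open>d\<^sub>m = v\<^bsub>N-1-m\<^esub> div N\<close>.
  If \<open>p = 1\<close> or \<open>\<upsilon> = 1\<close>, already the monomials \<open>x\<^sup>m y\<^bsup>d\<^sub>m\<^esup>\<close> have order at least \<open>c\<close>.
\<close>

section \<open>Ideals and quotient dimensions\<close>

lemma ideal_of_Inter:
  assumes "\<And>I. I \<in> \<I> \<Longrightarrow> ideal_of UNIV I"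
  shows "ideal_of UNIV (\<Inter>\<I>)"
  using assms unfolding ideal_of_def by auto

lemma ideal_of_ideal_gen: "ideal_of UNIV (ideal_gen S)"
  unfolding ideal_gen_def by (rule hull_in) (auto intro!: ideal_of_Inter)

lemma ideal_gen_superset: "S \<subseteq> ideal_gen S"
  unfolding ideal_gen_def by (rule hull_subset)

lemma ideal_gen_minimal: "S \<subseteq> I \<Longrightarrow> ideal_of UNIV I \<Longrightarrow> ideal_gen S \<subseteq> I"
  unfolding ideal_gen_def by (rule hull_minimal)

lemma ideal_of_zero: "ideal_of R I \<Longrightarrow> 0 \<in> I"
  and ideal_of_add: "ideal_of R I \<Longrightarrow> a \<in> I \<Longrightarrow> b \<in> I \<Longrightarrow> a + b \<in> I"
  and ideal_of_mult: "ideal_of R I \<Longrightarrow> c \<in> R \<Longrightarrow> a \<in> I \<Longrightarrow> c * a \<in> I"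
  and ideal_of_subset: "ideal_of R I \<Longrightarrow> I \<subseteq> R"
  unfolding ideal_of_def by auto

lemma ideal_of_mult_UNIV: "ideal_of UNIV I \<Longrightarrow> a \<in> I \<Longrightarrow> c * a \<in> I"
  by (simp add: ideal_of_mult)

lemma ideal_of_uminus: "ideal_of UNIV I \<Longrightarrow> a \<in> I \<Longrightarrow> - a \<in> I"
  using ideal_of_mult_UNIV[of I a "-1"] by simp

lemma ideal_of_diff: "ideal_of UNIV I \<Longrightarrow> a \<in> I \<Longrightarrow> b \<in> I \<Longrightarrow> a - b \<in> I"
  using ideal_of_add[of UNIV I a "- b"] ideal_of_uminus[of I b] by simp

lemma ideal_of_sum:
  assumes "ideal_of R I" "\<And>k. k \<in> K \<Longrightarrow> f k \<in> I"
  shows "(\<Sum>k\<in>K. f k) \<in> I"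
  using assms(2)
  by (induction K rule: infinite_finite_induct)
     (auto intro: ideal_of_zero[OF assms(1)] ideal_of_add[OF assms(1)])

text \<open>Two coefficient families for the same vector differ by a combination in
  \<open>W\<close>, so independence modulo \<open>W\<close> gives uniqueness. The basis may be
  indexed by any finite set, such as a set of gaps.\<close>

lemma quot_dimI:
  fixes b :: "'s \<Rightarrow> 'v::ab_group_add" and scale :: "'a::field \<Rightarrow> 'v \<Rightarrow> 'v"
  assumes fin: "finite S" and card: "card S = n" and V: "\<And>t. t \<in> S \<Longrightarrow> b t \<in> V"
    and scale: "\<And>c c' v. scale (c - c') v = scale c v - scale c' v"
    and W: "\<And>u v. u \<in> W \<Longrightarrow> v \<in> W \<Longrightarrow> u - v \<in> W"
    and spans: "\<And>v. v \<in> V \<Longrightarrow> \<exists>c. v - (\<Sum>t\<in>S. scale (c t) (b t)) \<in> W"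
    and indep: "\<And>c t. (\<Sum>t\<in>S. scale (c t) (b t)) \<in> W \<Longrightarrow> t \<in> S \<Longrightarrow> c t = 0"
  shows "quot_dim scale V W n"
proof -
  obtain h where h: "bij_betw h {..<n} S"
    using ex_bij_betw_nat_finite[OF fin] card by (auto simp: atLeast0LessThan)
  have reindex: "(\<Sum>k<n. scale (c k) (b (h k))) = (\<Sum>t\<in>S. scale (c (the_inv_into {..<n} h t)) (b t))" for c
    using h by (subst sum.reindex_bij_betw[OF h, symmetric])
      (auto intro!: sum.cong simp: the_inv_into_f_f bij_betw_def)
  show ?thesis
    unfolding quot_dim_def
  proof (intro exI[of _ "b \<circ> h"] conjI ballI allI impI)
    fix k assume "k < n"
    then show "(b \<circ> h) k \<in> V" using V h by (auto simp: bij_betw_def)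
  next
    fix v assume "v \<in> V"
    then obtain c where c: "v - (\<Sum>t\<in>S. scale (c t) (b t)) \<in> W" using spans by blast
    show "\<exists>!c. (\<forall>k\<ge>n. c k = 0) \<and> v - (\<Sum>k<n. scale (c k) ((b \<circ> h) k)) \<in> W"
    proof (rule ex1I[of _ "\<lambda>k. if k < n then c (h k) else 0"])
      have "(\<Sum>k<n. scale (if k < n then c (h k) else 0) ((b \<circ> h) k)) = (\<Sum>t\<in>S. scale (c t) (b t))"
        by (subst sum.reindex_bij_betw[OF h, symmetric]) (auto intro!: sum.cong)
      then show "(\<forall>k\<ge>n. (if k < n then c (h k) else 0) = 0) \<and>
          v - (\<Sum>k<n. scale (if k < n then c (h k) else 0) ((b \<circ> h) k)) \<in> W"
        using c by simp
    next
      fix c' assume c': "(\<forall>k\<ge>n. c' k = 0) \<and> v - (\<Sum>k<n. scale (c' k) ((b \<circ> h) k)) \<in> W"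
      let ?c' = "\<lambda>t. c' (the_inv_into {..<n} h t)"
      have "(v - (\<Sum>t\<in>S. scale (c t) (b t))) - (v - (\<Sum>t\<in>S. scale (?c' t) (b t))) \<in> W"
        using W[OF c, of "v - (\<Sum>t\<in>S. scale (?c' t) (b t))"] c' reindex[of c'] by simp
      moreover have "(v - (\<Sum>t\<in>S. scale (c t) (b t))) - (v - (\<Sum>t\<in>S. scale (?c' t) (b t)))
          = (\<Sum>t\<in>S. scale (?c' t - c t) (b t))"
        by (simp add: scale sum_subtractf)
      ultimately have eq: "?c' t - c t = 0" if "t \<in> S" for t
        using indep[of "\<lambda>t. ?c' t - c t" t] that by simp
      show "c' = (\<lambda>k. if k < n then c (h k) else 0)"
      proof
        fix k
        show "c' k = (if k < n then c (h k) else 0)"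
        proof (cases "k < n")
          case True
          then have "h k \<in> S" "the_inv_into {..<n} h (h k) = k"
            using h by (auto simp: bij_betw_def the_inv_into_f_f)
          then show ?thesis using eq[of "h k"] True by simp
        next
          case False
          then show ?thesis using c' by simp
        qed
      qed
    qed
  qed
qed

section \<open>Power series in two variables\<close>

lemma fps_mult_nth_cong:
  assumes "\<And>k. k \<le> n \<Longrightarrow> f $ k = f' $ k" "\<And>k. k \<le> n \<Longrightarrow> g $ k = g' $ k"
  shows "(f * g) $ n = (f' * g') $ n"
  unfolding fps_mult_nth using assms by (intro sum.cong) auto

text \<open>With \<open>m = 0\<close> this says that the series vanishing below \<open>n\<close>
  absorb multiplication by arbitrary series, which is its main use.\<close>

lemma fps_mult_nth_zero:
  fixes f g :: "'a::comm_ring_1 fps"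
  assumes "\<And>i. i < m \<Longrightarrow> f $ i = 0" "\<And>i. i < n \<Longrightarrow> g $ i = 0" "k < m + n"
  shows "(f * g) $ k = 0"
proof -
  have "f $ i * g $ (k - i) = 0" if "i \<le> k" for i
  proof (cases "i < m")
    case True
    then show ?thesis using assms(1) by simp
  next
    case False
    then have "k - i < n" using assms(3) that by linarith
    then show ?thesis using assms(2) by simp
  qed
  then show ?thesis unfolding fps_mult_nth by (intro sum.neutral) auto
qed

section \<open>Substitution of one-variable series as a ring homomorphism\<close>

lemma subst_xy_nth:
  fixes X Y :: "'a::field fps"
  assumes "Y $ 0 = 0" "n \<le> M"
  shows "subst_xy X Y f $ n = (\<Sum>j\<le>M. (f $ j oo X) * Y ^ j) $ n"
proof -
  have "((f $ j oo X) * Y ^ j) $ n = 0" if "n < j" for j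
    using fps_mult_nth_zero[of 0 "f $ j oo X" j "Y ^ j" n] startsby_zero_power_prefix[OF assms(1)] that
    by auto
  then have "(\<Sum>j\<le>M. ((f $ j oo X) * Y ^ j) $ n) = (\<Sum>j\<le>n. ((f $ j oo X) * Y ^ j) $ n)"
    using assms(2) by (intro sum.mono_neutral_right) auto
  then show ?thesis by (simp add: subst_xy_def fps_sum_nth)
qed

lemma subst_xy_add: "subst_xy X Y (f + g) = subst_xy X Y f + subst_xy X Y g"
  by (rule fps_ext) (simp add: subst_xy_def fps_compose_add_distrib algebra_simps sum.distrib)

lemma subst_xy_uminus: "subst_xy X Y (- f) = - subst_xy X Y f"
  by (rule fps_ext) (simp add: subst_xy_def fps_compose_uminus sum_negf)

lemma subst_xy_diff: "subst_xy X Y (f - g) = subst_xy X Y f - subst_xy X Y g"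
  using subst_xy_add[of X Y f "- g"] by (simp add: subst_xy_uminus)

lemma subst_xy_0 [simp]: "subst_xy X Y 0 = 0"
  by (rule fps_ext) (simp add: subst_xy_def)

lemma subst_xy_sum: "subst_xy X Y (\<Sum>k\<in>K. f k) = (\<Sum>k\<in>K. subst_xy X Y (f k))"
  by (induction K rule: infinite_finite_induct) (auto simp: subst_xy_add)

lemma subst_xy_mult:
  fixes X Y :: "'a::field fps"
  assumes X: "X $ 0 = 0" and Y: "Y $ 0 = 0"
  shows "subst_xy X Y (f * g) = subst_xy X Y f * subst_xy X Y g"
proof (rule fps_ext)
  fix n
  define F where "F j = f $ j oo X" for j
  define G where "G j = g $ j oo X" for j
  have FG: "((f * g) $ j oo X) = (\<Sum>k\<le>j. F k * G (j - k))" for j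
    by (simp add: fps_mult_nth fps_compose_sum_distrib fps_compose_mult_distrib[OF X] F_def G_def
        atLeast0AtMost)
  have "(subst_xy X Y f * subst_xy X Y g) $ n = ((\<Sum>j\<le>n. F j * Y ^ j) * (\<Sum>k\<le>n. G k * Y ^ k)) $ n"
    by (rule fps_mult_nth_cong) (auto simp: F_def G_def intro!: subst_xy_nth[OF Y])
  also have "\<dots> = (\<Sum>(j, k)\<in>{..n} \<times> {..n}. (F j * G k * Y ^ (j + k)) $ n)"
    by (simp add: sum_product sum.cartesian_product fps_sum_nth power_add mult_ac case_prod_unfold)
  \<comment> \<open>Pairs with \<open>j + k > n\<close> drop out, since \<open>Y ^ (j + k)\<close>
    has order at least \<open>j + k\<close>; the remaining triangle is then summed along its
    diagonals.\<close>
  also have "\<dots> = (\<Sum>(j, k)\<in>{(j, k). j + k \<le> n}. (F j * G k * Y ^ (j + k)) $ n)"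
  proof (rule sum.mono_neutral_right)
    have vanish: "(F j * G k * Y ^ (j + k)) $ n = 0" if "n < j + k" for j k
      using fps_mult_nth_zero[of 0 "F j * G k" "j + k" "Y ^ (j + k)" n]
        startsby_zero_power_prefix[OF Y] that by auto
    then show "\<forall>i\<in>{..n} \<times> {..n} - {(j, k). j + k \<le> n}. (case i of (j, k) \<Rightarrow> (F j * G k * Y ^ (j + k)) $ n) = 0"
      by clarsimp (meson vanish not_le)
  qed auto
  also have "\<dots> = (\<Sum>l\<le>n. \<Sum>j\<le>l. (F j * G (l - j) * Y ^ (j + (l - j))) $ n)"
    by (rule sum.triangle_reindex_eq)
  also have "\<dots> = subst_xy X Y (f * g) $ n"
    by (simp add: subst_xy_def FG fps_sum_nth sum_distrib_right)
  finally show "subst_xy X Y (f * g) $ n = (subst_xy X Y f * subst_xy X Y g) $ n" by simp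
qed

text \<open>The embedding of the series in y; its values serve as the coefficients in
  \<open>combination\<close>, and \<open>subst_xy\<close> turns them into series in
  \<open>Y\<close>.\<close>

definition series_y :: "'a::field fps \<Rightarrow> 'a fps fps" where
  "series_y a = Abs_fps (\<lambda>j. fps_const (a $ j))"

lemma series_y_nth [simp]: "series_y a $ j = fps_const (a $ j)"
  by (simp add: series_y_def)

lemma subst_xy_series_y: "subst_xy X Y (series_y a) = a oo Y"
  by (rule fps_ext) (simp add: subst_xy_def fps_compose_nth fps_sum_nth atLeast0AtMost)

lemma subst_xy_const:
  fixes X Y :: "'a::field fps"
  assumes "Y $ 0 = 0"
  shows "subst_xy X Y (fps_const u) = u oo X"
proof (rule fps_ext)
  fix n
  have "((fps_const u $ j oo X) * Y ^ j) $ n = (if j = 0 then (u oo X) $ n else 0)" for j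
    by auto
  then show "subst_xy X Y (fps_const u) $ n = (u oo X) $ n"
    by (simp add: subst_xy_def fps_sum_nth)
qed

lemma subst_xy_varx: "X $ 0 = 0 \<Longrightarrow> Y $ 0 = 0 \<Longrightarrow> subst_xy X Y varx = X"
  by (simp add: varx_def subst_xy_const fps_compose_fps_X)

lemma vary_eq_series_y: "vary = series_y fps_X"
  by (rule fps_ext) (simp add: vary_def fps_X_def)

lemma subst_xy_vary: "Y $ 0 = 0 \<Longrightarrow> subst_xy X Y vary = Y"
  by (simp add: vary_eq_series_y subst_xy_series_y fps_X_fps_compose_startby0)

lemma subst_xy_1: "Y $ 0 = 0 \<Longrightarrow> subst_xy X Y 1 = 1"
  using subst_xy_const[of Y X 1] by simp

lemma subst_xy_power:
  "X $ 0 = 0 \<Longrightarrow> Y $ 0 = 0 \<Longrightarrow> subst_xy X Y (f ^ n) = subst_xy X Y f ^ n"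
  by (induction n) (auto simp: subst_xy_1 subst_xy_mult)

section \<open>Monomials and leading monomials\<close>

lemma monom_xy_nth: "monom_xy (i, j) $ k = (if k = j then fps_X ^ i else 0)"
  by (simp add: varx_def vary_def fps_const_power)

declare monom_xy.simps [simp del]

lemma coeff_monom_xy: "coeff_xy (monom_xy m) m' = (if m' = m then 1 else 0)"
  by (cases m; cases m') (auto simp: monom_xy_nth)

lemma monom_xy_mult: "monom_xy (i, j) * monom_xy (i', j') = monom_xy (i + i', j + j')"
  by (simp add: monom_xy.simps power_add mult_ac)

lemma coeff_vary_power_mult: "(vary ^ d * f) $ k = (if k < d then 0 else f $ (k - d))"
  by (simp add: vary_def fps_X_power_mult_nth)

text \<open>The least monomial is found in two stages: first the order in y, then the order in x of
  the corresponding coefficient.\<close>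

lemma has_leading_exists:
  assumes "f \<noteq> 0"
  shows "\<exists>m. has_leading f m"
proof -
  define j where "j = subdegree f"
  define i where "i = subdegree (f $ j)"
  have "f $ j \<noteq> 0" using assms by (simp add: j_def)
  then have "f $ j $ i \<noteq> 0" by (simp add: i_def)
  moreover have "(i', j') = (i, j) \<or> mon_less (i, j) (i', j')" if "f $ j' $ i' \<noteq> 0" for i' j'
  proof -
    have "f $ j' \<noteq> 0" using that by auto
    then have "j \<le> j'" unfolding j_def by (rule subdegree_leI)
    moreover have "i \<le> i'" if "j' = j"
      using \<open>f $ j' $ i' \<noteq> 0\<close> that unfolding i_def by (auto intro: subdegree_leI)
    ultimately show ?thesis by auto
  qed
  ultimately have "has_leading f (i, j)" unfolding has_leading_def by auto
  then show ?thesis ..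
qed

lemma has_leading_iff:
  "has_leading f (i, j) \<longleftrightarrow> (\<forall>k<j. f $ k = 0) \<and> f $ j $ i \<noteq> 0 \<and> (\<forall>k<i. f $ j $ k = 0)"
proof
  assume h: "has_leading f (i, j)"
  then have lead: "(i', j') = (i, j) \<or> mon_less (i, j) (i', j')" if "f $ j' $ i' \<noteq> 0" for i' j'
    using that unfolding has_leading_def by (metis coeff_xy.simps)
  have "f $ k $ l = 0" if "k < j" for k l using lead[of k l] that by auto
  moreover have "f $ j $ k = 0" if "k < i" for k using lead[of j k] that by auto
  ultimately show "(\<forall>k<j. f $ k = 0) \<and> f $ j $ i \<noteq> 0 \<and> (\<forall>k<i. f $ j $ k = 0)"
    using h by (auto simp: has_leading_def intro: fps_ext)
next
  assume h: "(\<forall>k<j. f $ k = 0) \<and> f $ j $ i \<noteq> 0 \<and> (\<forall>k<i. f $ j $ k = 0)"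
  have "(i', j') = (i, j) \<or> mon_less (i, j) (i', j')" if "f $ j' $ i' \<noteq> 0" for i' j'
  proof -
    have "\<not> j' < j" using h that by auto
    moreover have "\<not> i' < i" if "j' = j" using h that \<open>f $ j' $ i' \<noteq> 0\<close> by auto
    ultimately show ?thesis by auto
  qed
  then show "has_leading f (i, j)" using h unfolding has_leading_def by auto
qed

section \<open>Staircase diagrams and their monomial ideals\<close>

lemma fps_truncated_sum_nth:
  fixes w :: "'a::field fps"
  shows "((\<Sum>m<N. fps_const (\<alpha> m) * fps_X ^ m) + w * fps_X ^ N) $ i = (if i < N then \<alpha> i else w $ (i - N))"
proof -
  have "(\<Sum>m<N. fps_const (\<alpha> m) * fps_X ^ m) $ i = (\<Sum>m<N. if m = i then \<alpha> m else 0)"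
    unfolding fps_sum_nth by (intro sum.cong) auto
  then show ?thesis by (simp add: fps_X_power_mult_right_nth)
qed

lemma fps_eq_sum_shift:
  fixes u :: "'a::field fps"
  shows "u = (\<Sum>m<N. fps_const (u $ m) * fps_X ^ m) + fps_shift N u * fps_X ^ N"
  by (rule fps_ext, subst fps_truncated_sum_nth) simp

lemma fps_mult_nth_lead:
  fixes f g :: "'a::comm_ring_1 fps"
  assumes "\<And>k. k < j \<Longrightarrow> f $ k = 0"
  shows "(f * g) $ j = f $ j * g $ 0"
proof -
  have "(\<Sum>i=0..j. f $ i * g $ (j - i)) = (\<Sum>i\<in>{j}. f $ i * g $ (j - i))"
    using assms by (intro sum.mono_neutral_right) auto
  then show ?thesis by (simp add: fps_mult_nth)
qed

text \<open>Division with remainder by \<open>e N\<close>: \<open>h\<close> is the quotient, and the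
  \<open>a m\<close> are the coefficients of the remainder with respect to \<open>e m\<close>, the
  substitutes for the powers \<open>x^m\<close> with \<open>m < N\<close>.\<close>

definition combination ::
    "nat \<Rightarrow> (nat \<Rightarrow> 'a::field fps fps) \<Rightarrow> (nat \<Rightarrow> 'a fps) \<Rightarrow> 'a fps fps \<Rightarrow> 'a fps fps" where
  "combination N e a h = (\<Sum>m<N. series_y (a m) * e m) + h * e N"

text \<open>
  Weierstrass-type division by \<open>e N\<close>: subtracting the combination with coefficients constant in \<open>y\<close>
  that matches \<open>f\<close> modulo \<open>y\<close> leaves \<open>y\<close> times a series \<open>T f\<close>, and this is iterated.
\<close>

lemma combination_exists:
  fixes f :: "'a::field fps fps"
  assumes e: "\<And>m. m \<le> N \<Longrightarrow> e m $ 0 = fps_X ^ m"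
  shows "\<exists>a h. f = combination N e a h"
proof -
  define D where "D f = (\<Sum>m<N. fps_const (fps_const (f $ 0 $ m)) * e m)
      + fps_const (fps_shift N (f $ 0)) * e N" for f
  define T where "T f = fps_shift 1 (f - D f)" for f
  define a where "a f m = Abs_fps (\<lambda>k. (T ^^ k) f $ 0 $ m)" for f m
  define h where "h f = Abs_fps (\<lambda>k. fps_shift N ((T ^^ k) f $ 0))" for f
  have D0: "D f $ 0 = f $ 0" for f
    using fps_eq_sum_shift[of "f $ 0" N] by (simp add: D_def fps_sum_nth e)
  have T: "f = D f + fps_X * T f" for f
    by (rule fps_ext) (auto simp: T_def D0 fps_X_mult_nth)
  have a: "series_y (a f m) = fps_const (fps_const (f $ 0 $ m)) + fps_X * series_y (a (T f) m)" for f m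
    by (rule fps_ext, case_tac n) (auto simp: a_def funpow_swap1)
  have h: "h f = fps_const (fps_shift N (f $ 0)) + fps_X * h (T f)" for f
    by (rule fps_ext, case_tac n) (auto simp: h_def funpow_swap1)
  have step: "combination N e (a f) (h f) = D f + fps_X * combination N e (a (T f)) (h (T f))" for f
    unfolding combination_def D_def
    by (subst a, subst h) (simp add: algebra_simps sum.distrib sum_distrib_left)
  \<comment> \<open>The error for \<open>f\<close> is y times the error for \<open>T f\<close>, so
    the induction has to treat all series at once.\<close>
  have "\<forall>f. (f - combination N e (a f) (h f)) $ j = 0" for j
  proof (induction j)
    case 0
    show ?case
    proof
      fix f
      show "(f - combination N e (a f) (h f)) $ 0 = 0" by (subst step) (simp add: D0)
    qed
  next
    case (Suc j)
    show ?case
    proof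
      fix f
      have "f - combination N e (a f) (h f) = fps_X * (T f - combination N e (a (T f)) (h (T f)))"
        by (subst step, subst (1) T) (simp add: algebra_simps)
      then show "(f - combination N e (a f) (h f)) $ Suc j = 0" using Suc by simp
    qed
  qed
  then have "f - combination N e (a f) (h f) = 0" by (intro fps_ext) auto
  then show ?thesis by auto
qed

text \<open>Modulo y each \<open>e m\<close> is \<open>x^m\<close>, so in the lowest power of y that
  can survive the combination is a plain series in x.\<close>

lemma combination_nth_lead:
  assumes e: "\<And>m. m \<le> N \<Longrightarrow> e m $ 0 = fps_X ^ m"
    and a: "\<And>m k. m < N \<Longrightarrow> k < j \<Longrightarrow> a m $ k = 0" and h: "\<And>k. k < j \<Longrightarrow> h $ k = 0"
  shows "combination N e a h $ j $ i = (if i < N then a i $ j else h $ j $ (i - N))"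
proof -
  have "(series_y (a m) * e m) $ j = fps_const (a m $ j) * fps_X ^ m" if "m < N" for m
    using that a by (subst fps_mult_nth_lead) (auto simp: e)
  moreover have "(h * e N) $ j = h $ j * fps_X ^ N"
    using h by (subst fps_mult_nth_lead) (auto simp: e)
  ultimately have "combination N e a h $ j
      = (\<Sum>m<N. fps_const (a m $ j) * fps_X ^ m) + h $ j * fps_X ^ N"
    by (simp add: combination_def fps_sum_nth)
  then show ?thesis by (simp only: fps_truncated_sum_nth)
qed

text \<open>Uniqueness of the division: the vanishing of the lowest layers in y is passed on to
  \<open>a\<close> and \<open>h\<close>, one power of y at a time.\<close>

lemma combination_vanish:
  assumes e: "\<And>m. m \<le> N \<Longrightarrow> e m $ 0 = fps_X ^ m"
    and z: "\<And>k. k < j \<Longrightarrow> combination N e a h $ k = 0" and "k < j"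
  shows "(\<forall>m<N. a m $ k = 0) \<and> h $ k = 0"
  using \<open>k < j\<close>
proof (induction k rule: less_induct)
  case (less k)
  have c: "combination N e a h $ k $ i = (if i < N then a i $ k else h $ k $ (i - N))" for i
    using less by (intro combination_nth_lead[OF e]) auto
  have "h $ k $ i = 0" for i using c[of "i + N"] z[OF less.prems] by simp
  moreover have "a m $ k = 0" if "m < N" for m using c[of m] z[OF less.prems] that by simp
  ultimately show ?case by (auto intro: fps_ext)
qed

lemma combination_leading:
  assumes e: "\<And>m. m \<le> N \<Longrightarrow> e m $ 0 = fps_X ^ m"
    and lead: "has_leading (combination N e a h) (i, j)" and "i < N"
  shows "a i $ j \<noteq> 0"
proof -
  have z: "combination N e a h $ k = 0" if "k < j" for k
    using lead that by (simp add: has_leading_iff)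
  have "combination N e a h $ j $ i = (if i < N then a i $ j else h $ j $ (i - N))"
    using combination_vanish[where N = N and e = e and j = j and a = a and h = h, OF e z]
    by (intro combination_nth_lead[OF e]) auto
  then show ?thesis using lead \<open>i < N\<close> by (simp add: has_leading_iff)
qed

lemma series_y_shift:
  assumes "\<And>k. k < d \<Longrightarrow> a $ k = 0"
  shows "series_y a = vary ^ d * series_y (fps_shift d a)"
  by (rule fps_ext) (use assms in \<open>auto simp: coeff_vary_power_mult\<close>)

text \<open>The factor \<open>y^(d m)\<close> of \<open>a m\<close> is moved over to
  \<open>e m\<close>.\<close>

lemma combination_in_ideal:
  assumes I: "ideal_of UNIV I" and gens: "\<And>m. m < N \<Longrightarrow> vary ^ d m * e m \<in> I" and "e N \<in> I"
    and a: "\<And>m k. m < N \<Longrightarrow> k < d m \<Longrightarrow> a m $ k = 0"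
  shows "combination N e a h \<in> I"
proof -
  have "series_y (a m) * e m \<in> I" if "m < N" for m
  proof -
    have "series_y (a m) = vary ^ d m * series_y (fps_shift (d m) (a m))"
      using a[OF that] by (rule series_y_shift)
    then have "series_y (a m) * e m = series_y (fps_shift (d m) (a m)) * (vary ^ d m * e m)"
      by (simp only: mult_ac)
    then show ?thesis using ideal_of_mult_UNIV[OF I gens[OF that]] by (simp only:)
  qed
  moreover have "h * e N \<in> I" using ideal_of_mult_UNIV[OF I \<open>e N \<in> I\<close>] .
  ultimately show ?thesis
    unfolding combination_def by (intro ideal_of_add[OF I] ideal_of_sum[OF I]) auto
qed

text \<open>Here every \<open>e m\<close> is constant in y, so the layers in y do not interact and
  all coefficients can be read off directly.\<close>

lemma combination_monom_nth:
  "combination N (\<lambda>m. monom_xy (m, 0)) a h $ j $ i = (if i < N then a i $ j else h $ j $ (i - N))"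
proof -
  have m0: "monom_xy (m, 0) = fps_const (fps_X ^ m)" for m
    by (simp add: monom_xy.simps varx_def)
  have "combination N (\<lambda>m. monom_xy (m, 0)) a h $ j
      = (\<Sum>m<N. fps_const (a m $ j) * fps_X ^ m) + h $ j * fps_X ^ N"
    by (simp add: combination_def m0 fps_sum_nth[of _ "{..<N}" j])
  then show ?thesis by (simp only: fps_truncated_sum_nth)
qed

section \<open>Ideals of series supported outside a diagram\<close>

lemma diagram_ideal_iff: "f \<in> diagram_ideal L \<longleftrightarrow> (\<forall>i j. (i, j) \<in> L \<longrightarrow> f $ j $ i = 0)"
  unfolding diagram_ideal_def by auto

lemma monom_in_diagram_ideal: "monom_xy m \<in> diagram_ideal L \<longleftrightarrow> m \<notin> L"
  unfolding diagram_ideal_def by (simp add: coeff_monom_xy del: split_paired_All)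

text \<open>The coefficient of \<open>c * f\<close> at a box of \<open>L\<close> only involves
  coefficients of \<open>f\<close> at boxes weakly above and to the left, which are again in
  \<open>L\<close>.\<close>

lemma ideal_of_diagram_ideal:
  assumes down: "\<And>i j i' j'. (i, j) \<in> L \<Longrightarrow> i' \<le> i \<Longrightarrow> j' \<le> j \<Longrightarrow> (i', j') \<in> L"
  shows "ideal_of UNIV (diagram_ideal L)"
proof -
  have "(c * f) $ j $ i = 0" if f: "f \<in> diagram_ideal L" and ij: "(i, j) \<in> L" for c f :: "'a fps fps" and i j
  proof -
    have "f $ (j - l) $ (i - k) = 0" for k l
      using f down[OF ij, of "i - k" "j - l"] by (simp add: diagram_ideal_iff)
    then show ?thesis by (simp add: fps_mult_nth fps_sum_nth)
  qed
  then show ?thesis unfolding ideal_of_def by (auto simp: diagram_ideal_iff)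
qed

definition staircase_diagram :: "nat \<Rightarrow> (nat \<Rightarrow> nat) \<Rightarrow> (nat \<times> nat) set" where
  "staircase_diagram N d = {(i, j). i < N \<and> j < d i}"

text \<open>Strictly increasing keys make \<open>f\<close> injective on the set of entries, so the
  theory of sorting by keys can be interpreted on that set.\<close>

lemma (in linorder) sorted_key_list_of_set_eqI:
  assumes "sorted_wrt (<) (map f l)"
  shows "sorted_key_list_of_set f (set l) = l"
proof -
  have "distinct (map f l)" "sorted (map f l)" using assms strict_sorted_iff by blast+
  then have "distinct l" and inj: "inj_on f (set l)" by (auto simp: distinct_map)
  interpret folding_insort_key "(\<le>)" "(<)" "set l" f
    by standard (rule inj)
  show ?thesis
    using \<open>sorted (map f l)\<close> \<open>distinct l\<close> by (intro idem_if_sorted_distinct) auto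
qed

text \<open>Strict decrease of the row lengths gives each of the \<open>N\<close> rows exactly one
  outer corner. Row \<open>N - 1\<close> is empty, which makes \<open>(N - 1, 0)\<close> the corner
  of the pure power of x.\<close>

locale staircase =
  fixes N :: nat and d :: "nat \<Rightarrow> nat"
  assumes N_pos: "0 < N" and d_last: "d (N - 1) = 0"
    and d_strict: "\<And>m m'. m < m' \<Longrightarrow> m' < N \<Longrightarrow> d m' < d m"
begin

abbreviation "\<Lambda> \<equiv> staircase_diagram N d"

lemma mem_diagram: "(i, j) \<in> \<Lambda> \<longleftrightarrow> i < N \<and> j < d i"
  by (simp add: staircase_diagram_def)

lemma d_antimono: "m \<le> m' \<Longrightarrow> m' < N \<Longrightarrow> d m' \<le> d m"
  using d_strict[of m m'] by (cases "m = m'") auto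

lemma diagram_down: "(i, j) \<in> \<Lambda> \<Longrightarrow> i' \<le> i \<Longrightarrow> j' \<le> j \<Longrightarrow> (i', j') \<in> \<Lambda>"
  using d_antimono[of i' i] by (auto simp: mem_diagram)

lemma ideal_of_staircase: "ideal_of UNIV (diagram_ideal \<Lambda>)"
  by (rule ideal_of_diagram_ideal) (rule diagram_down)

lemma row_length_diagram: "i < N \<Longrightarrow> row_length \<Lambda> i = d i"
  by (simp add: row_length_def mem_diagram)

text \<open>The first missing box of a row is minimal because the rows above are strictly longer.
  From row \<open>N\<close> on, no box is minimal, since \<open>(N - 1, 0)\<close> already lies
  outside the diagram.\<close>

lemma outer_corners_diagram: "outer_corners \<Lambda> = (\<lambda>m. (m, d m)) ` {..<N}"
proof (intro set_eqI iffI)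
  fix c assume "c \<in> outer_corners \<Lambda>"
  then obtain i j where c: "c = (i, j)" and out: "(i, j) \<notin> \<Lambda>"
    and min: "\<And>i' j'. (i', j') \<notin> \<Lambda> \<Longrightarrow> i' \<le> i \<Longrightarrow> j' \<le> j \<Longrightarrow> i' = i \<and> j' = j"
    by (auto simp: outer_corners_def)
  have "i < N"
  proof (rule ccontr)
    assume "\<not> i < N"
    moreover have "(N - 1, 0) \<notin> \<Lambda>" using d_last by (simp add: mem_diagram)
    ultimately have "N - 1 = i" using min[of "N - 1" 0] by simp
    then show False using \<open>\<not> i < N\<close> N_pos by simp
  qed
  moreover have "j = d i" using min[of i "d i"] out \<open>i < N\<close> by (auto simp: mem_diagram)
  ultimately show "c \<in> (\<lambda>m. (m, d m)) ` {..<N}" using c by auto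
next
  fix c assume "c \<in> (\<lambda>m. (m, d m)) ` {..<N}"
  then obtain m where m: "m < N" "c = (m, d m)" by auto
  have "i' = m \<and> j' = d m" if "(i', j') \<notin> \<Lambda>" "i' \<le> m" "j' \<le> d m" for i' j'
    using that m d_strict[of i' m] by (cases "i' = m") (auto simp: mem_diagram)
  then show "c \<in> outer_corners \<Lambda>" using m by (auto simp: outer_corners_def mem_diagram)
qed

lemma card_outer_corners: "card (outer_corners \<Lambda>) = N"
  unfolding outer_corners_diagram by (subst card_image) (auto intro: inj_onI)

lemma corner_list_diagram: "corner_list \<Lambda> = rev (map (\<lambda>m. (m, d m)) [0..<N])"
proof -
  have "sorted_wrt (<) (map snd (rev (map (\<lambda>m. (m, d m)) [0..<N])))"
    by (auto simp: sorted_wrt_iff_nth_less rev_nth intro!: d_strict)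
  moreover have "set (rev (map (\<lambda>m. (m, d m)) [0..<N])) = outer_corners \<Lambda>"
    by (simp add: outer_corners_diagram atLeast0LessThan)
  ultimately show ?thesis
    unfolding corner_list_def by (metis sorted_key_list_of_set_eqI)
qed

lemma hd_corner_list: "hd (corner_list \<Lambda>) = (N - 1, 0)"
  using N_pos d_last by (simp add: corner_list_diagram hd_rev last_map)

lemma last_corner_list: "last (corner_list \<Lambda>) = (0, d 0)"
  using N_pos by (simp add: corner_list_diagram last_rev hd_map)

text \<open>The first assumption keeps all leading monomials outside \<open>\<Lambda>\<close>.
  Conversely, each monomial outside \<open>\<Lambda>\<close> is a multiple of a corner monomial,
  which the second assumption provides as a leading one.\<close>

lemma leading_diagram_eq:
  assumes lead: "\<And>f m. f \<in> I \<Longrightarrow> has_leading f m \<Longrightarrow> m \<notin> \<Lambda>"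
    and corners: "\<And>m. m < N \<Longrightarrow> \<exists>f\<in>I. has_leading f (m, d m)"
  shows "leading_diagram I = \<Lambda>"
proof -
  have "leading_ideal I \<subseteq> diagram_ideal \<Lambda>"
    unfolding leading_ideal_def
  proof (rule ideal_gen_minimal[OF _ ideal_of_staircase])
    show "{monom_xy m |m. \<exists>f\<in>I. has_leading f m} \<subseteq> diagram_ideal \<Lambda>"
      using lead by (auto simp only: monom_in_diagram_ideal)
  qed
  then have "m \<in> leading_diagram I" if "m \<in> \<Lambda>" for m
    using that monom_in_diagram_ideal[of m \<Lambda>] by (auto simp: leading_diagram_def)
  moreover have "monom_xy (i, j) \<in> leading_ideal I" if "(i, j) \<notin> \<Lambda>" for i j
  proof -
    have "monom_xy (m, d m) \<in> leading_ideal I" if "m < N" for m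
      unfolding leading_ideal_def
      by (rule subsetD[OF ideal_gen_superset]) (use corners[OF that] in blast)
    then have mult: "monom_xy (k, l) * monom_xy (m, d m) \<in> leading_ideal I" if "m < N" for k l m
      using that unfolding leading_ideal_def by (intro ideal_of_mult_UNIV[OF ideal_of_ideal_gen])
    show ?thesis
    proof (cases "i < N")
      case True
      then show ?thesis
        using mult[OF True, of 0 "j - d i"] that unfolding monom_xy_mult by (simp add: mem_diagram)
    next
      case False
      then show ?thesis
        using mult[of "N - 1" "i - (N - 1)" j] N_pos d_last unfolding monom_xy_mult by (simp)
    qed
  qed
  ultimately show ?thesis by (auto simp: leading_diagram_def)
qed

lemma mem_diagram_ideal: "f \<in> diagram_ideal \<Lambda> \<longleftrightarrow> (\<forall>i<N. \<forall>j<d i. f $ j $ i = 0)"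
  unfolding diagram_ideal_def by (auto simp: mem_diagram)

lemma vary_power_mult_monom: "vary ^ k * monom_xy (i, j) = monom_xy (i, j + k)"
  by (simp add: monom_xy.simps power_add mult_ac)

text \<open>Division by \<open>x^N\<close> rewrites a possibly infinite sum of monomials as a finite
  combination of corner monomials with series coefficients.\<close>

lemma diagram_ideal_subset:
  fixes I :: "'a::field fps fps set"
  assumes I: "ideal_of UNIV I" and corners: "\<And>m. m < N \<Longrightarrow> monom_xy (m, d m) \<in> I"
  shows "diagram_ideal \<Lambda> \<subseteq> I"
proof
  fix f :: "'a fps fps"
  assume f: "f \<in> diagram_ideal \<Lambda>"
  obtain a h where fc: "f = combination N (\<lambda>m. monom_xy (m, 0)) a h"
    using combination_exists[of N "\<lambda>m. monom_xy (m, 0)" f] by (auto simp: monom_xy_nth)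
  have "a m $ k = 0" if "m < N" "k < d m" for m k
    using f that combination_monom_nth[of N a h k m] fc by (simp add: mem_diagram_ideal)
  moreover have "monom_xy (N, 0) \<in> I"
    using ideal_of_mult_UNIV[OF I corners[of "N - 1"], of "monom_xy (1, 0)"] N_pos d_last
    unfolding monom_xy_mult by (simp)
  ultimately show "f \<in> I"
    unfolding fc using I corners by (intro combination_in_ideal[where d = d]) (auto simp: vary_power_mult_monom)
qed

lemma diagram_ideal_eq_ideal_gen: "diagram_ideal \<Lambda> = ideal_gen (monom_xy ` outer_corners \<Lambda>)"
proof
  show "diagram_ideal \<Lambda> \<subseteq> ideal_gen (monom_xy ` outer_corners \<Lambda>)"
    using ideal_gen_superset[of "monom_xy ` outer_corners \<Lambda>"]
    by (intro diagram_ideal_subset ideal_of_ideal_gen) (auto simp: outer_corners_diagram)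
  show "ideal_gen (monom_xy ` outer_corners \<Lambda>) \<subseteq> diagram_ideal \<Lambda>"
    by (intro ideal_gen_minimal ideal_of_staircase)
       (auto simp: monom_in_diagram_ideal outer_corners_diagram mem_diagram)
qed

text \<open>All proper divisors of a corner monomial lie in \<open>\<Lambda>\<close>, where
  \<open>f\<close> has no coefficients, so only the constant term of \<open>c\<close>
  contributes.\<close>

lemma mult_corner_coeff:
  fixes c f :: "'a::field fps fps"
  assumes f: "f \<in> diagram_ideal \<Lambda>" and "m < N"
  shows "(c * f) $ d m $ m = c $ 0 $ 0 * f $ d m $ m"
proof -
  have z: "f $ (d m - l) $ (m - k) = 0" if "l \<le> d m" "k \<le> m" "l \<noteq> 0 \<or> k \<noteq> 0" for k l
  proof -
    have "(m - k, d m - l) \<in> \<Lambda>"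
      using that \<open>m < N\<close> d_strict[of "m - k" m] by (cases "k = 0") (auto simp: mem_diagram)
    then show ?thesis using f by (simp add: mem_diagram_ideal mem_diagram)
  qed
  have "(c * f) $ d m $ m = (\<Sum>l=0..d m. \<Sum>k=0..m. c $ l $ k * f $ (d m - l) $ (m - k))"
    by (simp add: fps_mult_nth fps_sum_nth)
  also have "\<dots> = (\<Sum>l\<in>{0}. \<Sum>k=0..m. c $ l $ k * f $ (d m - l) $ (m - k))"
    using z by (intro sum.mono_neutral_right) (auto intro!: sum.neutral)
  also have "\<dots> = (\<Sum>k=0..m. c $ 0 $ k * f $ d m $ (m - k))" by simp
  also have "\<dots> = (\<Sum>k\<in>{0}. c $ 0 $ k * f $ d m $ (m - k))"
    using z[of 0] by (intro sum.mono_neutral_right) auto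
  finally show ?thesis by simp
qed

text \<open>A factor without constant term kills the corner coefficients. Conversely, a series
  without corner coefficients is a combination of y times corner monomials and of
  \<open>x^N\<close>, which is x times the corner monomial \<open>x^(N-1)\<close>.\<close>

lemma maximal_mult_diagram_ideal:
  "ideal_mult (ideal_gen {varx, vary}) (diagram_ideal \<Lambda>) =
   {f \<in> diagram_ideal \<Lambda>. \<forall>m<N. f $ d m $ m = (0::'a::field)}" (is "?W = ?Z")
proof
  have "ideal_of UNIV {a :: 'a fps fps. a $ 0 $ 0 = 0}" by (auto simp: ideal_of_def)
  then have "ideal_gen {varx, vary} \<subseteq> {a :: 'a fps fps. a $ 0 $ 0 = 0}"
    by (intro ideal_gen_minimal) (auto simp: varx_def vary_def)
  moreover have I: "ideal_of UNIV (diagram_ideal \<Lambda> :: 'a fps fps set)"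
    by (rule ideal_of_staircase)
  moreover have "ideal_of UNIV ?Z"
    using I by (auto simp: ideal_of_def mult_corner_coeff)
  ultimately show "?W \<subseteq> ?Z"
    unfolding ideal_mult_def
    by (intro ideal_gen_minimal) (auto simp: mult_corner_coeff ideal_of_mult_UNIV)
  have W: "ideal_of UNIV ?W" unfolding ideal_mult_def by (rule ideal_of_ideal_gen)
  have gens: "v * monom_xy (m, d m) \<in> ?W" if "m < N" "v \<in> {varx, vary}" for v :: "'a fps fps" and m
  proof -
    have "(monom_xy (m, d m) :: 'a fps fps) \<in> diagram_ideal \<Lambda>" using that by (simp add: monom_in_diagram_ideal mem_diagram)
    moreover have "v \<in> ideal_gen {varx, vary}"
      by (rule subsetD[OF ideal_gen_superset]) (rule that(2))
    ultimately show ?thesis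
      unfolding ideal_mult_def by (intro subsetD[OF ideal_gen_superset] CollectI) blast
  qed
  show "?Z \<subseteq> ?W"
  proof
    fix f :: "'a fps fps"
    assume f: "f \<in> ?Z"
    obtain a h where fc: "f = combination N (\<lambda>m. monom_xy (m, 0)) a h"
      using combination_exists[of N "\<lambda>m. monom_xy (m, 0)" f] by (auto simp: monom_xy_nth)
    have "a m $ k = 0" if "m < N" "k < Suc (d m)" for m k
      using f that combination_monom_nth[of N a h k m] fc by (cases "k = d m") (auto simp: mem_diagram_ideal)
    moreover have "vary ^ Suc (d m) * monom_xy (m, 0) \<in> ?W" if "m < N" for m
      using gens[OF that, of vary] by (simp add: monom_xy.simps mult_ac)
    moreover have "monom_xy (N, 0) \<in> ?W"
    proof -
      have "(monom_xy (N, 0) :: 'a fps fps) = varx * monom_xy (N - 1, d (N - 1))"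
        using N_pos d_last by (cases N) (auto simp: monom_xy.simps)
      then show ?thesis using gens[of "N - 1" varx] N_pos by simp
    qed
    ultimately show "f \<in> ?W"
      unfolding fc using W by (intro combination_in_ideal[where d = "\<lambda>m. Suc (d m)"]) auto
  qed
qed

text \<open>The corner monomials represent a basis; the coordinates of a class are its corner
  coefficients.\<close>

lemma has_rank_diagram_ideal: "has_rank (diagram_ideal \<Lambda> :: 'a::field fps fps set) N"
  unfolding has_rank_def
proof (rule quot_dimI[where S = "{..<N}" and b = "\<lambda>m. monom_xy (m, d m)"])
  let ?I = "diagram_ideal \<Lambda> :: 'a fps fps set"
  have I: "ideal_of UNIV ?I" by (rule ideal_of_staircase)
  have scale_nth: "scale_xy c f $ j $ i = c * f $ j $ i" for c :: 'a and f i j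
    by (simp add: scale_xy_def)
  have corner: "(\<Sum>t<N. scale_xy (c t) (monom_xy (t, d t))) $ d m $ m = c m" if "m < N" for c :: "nat \<Rightarrow> 'a" and m
  proof -
    have "(monom_xy (t, d t) :: 'a fps fps) $ d m $ m = (if t = m then 1 else 0)" for t
      using coeff_monom_xy[of "(t, d t)" "(m, d m)"] by (auto)
    then have "(\<Sum>t<N. scale_xy (c t) (monom_xy (t, d t))) $ d m $ m = (\<Sum>t<N. if t = m then c t else 0)"
      by (simp add: fps_sum_nth scale_nth if_distrib[of "(*) _"] cong: if_cong)
    then show ?thesis using that by simp
  qed
  show "monom_xy (t, d t) \<in> ?I" if "t \<in> {..<N}" for t
    using that by (simp add: monom_in_diagram_ideal mem_diagram)
  then have comb: "(\<Sum>t<N. scale_xy (c t) (monom_xy (t, d t))) \<in> ?I" for c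
    unfolding scale_xy_def by (intro ideal_of_sum[OF I] ideal_of_mult_UNIV[OF I]) auto
  show "u - v \<in> ideal_mult (ideal_gen {varx, vary}) ?I"
    if "u \<in> ideal_mult (ideal_gen {varx, vary}) ?I" "v \<in> ideal_mult (ideal_gen {varx, vary}) ?I" for u v
    using that unfolding ideal_mult_def by (intro ideal_of_diff ideal_of_ideal_gen)
  show "\<exists>c. v - (\<Sum>t<N. scale_xy (c t) (monom_xy (t, d t))) \<in> ideal_mult (ideal_gen {varx, vary}) ?I"
    if "v \<in> ?I" for v
    using that comb corner unfolding maximal_mult_diagram_ideal
    by (intro exI[of _ "\<lambda>t. v $ d t $ t"]) (auto intro: ideal_of_diff[OF I])
  show "c t = 0" if "(\<Sum>t<N. scale_xy (c t) (monom_xy (t, d t))) \<in> ideal_mult (ideal_gen {varx, vary}) ?I"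
    "t \<in> {..<N}" for c t
    using that corner[of t c] unfolding maximal_mult_diagram_ideal by auto
qed (auto simp: scale_xy_def algebra_simps simp flip: fps_const_sub)

end

section \<open>Power series modules with an Apery basis\<close>

text \<open>
  \<open>v 0, \<dots>, v (N - 1)\<close> is the Apery set of a symmetric numerical semigroup with respect to \<open>N\<close>;
  the symmetry identifies the row lengths of the diagram with the numbers of gaps per residue class.
\<close>

locale apery =
  fixes N :: nat and v :: "nat \<Rightarrow> nat"
  assumes N_pos: "0 < N"
    and v_distinct: "\<And>m m'. m < N \<Longrightarrow> m' < N \<Longrightarrow> v m mod N = v m' mod N \<Longrightarrow> m = m'"
    and v_step: "\<And>m m'. m < m' \<Longrightarrow> m' < N \<Longrightarrow> v m + N \<le> v m'"
    and v_symmetric: "\<And>m. m < N \<Longrightarrow> v m + v (N - 1 - m) = v (N - 1)"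
begin

text \<open>The number of gaps in the residue class of \<open>v (N - 1 - m)\<close>. By symmetry it
  is also the least \<open>i\<close> with \<open>cond \<le> v m + N * i\<close>, see
  \<open>less_d_iff\<close>.\<close>

definition d :: "nat \<Rightarrow> nat" where
  "d m = v (N - 1 - m) div N"

text \<open>The Frobenius number plus one. Adding 1 before subtracting keeps the natural subtraction
  exact also for \<open>N = 1\<close>, where the conductor is 0.\<close>

definition cond :: nat where
  "cond = v (N - 1) + 1 - N"

definition \<Gamma> :: "nat set" where
  "\<Gamma> = {v m + N * i | m i. m < N}"

lemma v_0: "v 0 = 0"
  using v_symmetric[of 0] N_pos by simp

lemma v_le: "m < N \<Longrightarrow> v m \<le> v (N - 1)"
  using v_symmetric[of m] by linarith

sublocale staircase N d
proof
  show "d (N - 1) = 0" using v_0 by (simp add: d_def)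
  fix m m' assume m: "m < m'" "m' < N"
  then have "v (N - 1 - m') + N \<le> v (N - 1 - m)" by (intro v_step) auto
  then have "(v (N - 1 - m') + N) div N \<le> v (N - 1 - m) div N" by (rule div_le_mono)
  then show "d m' < d m" using N_pos by (simp add: d_def)
qed (rule N_pos)

lemma in_\<Gamma>: "m < N \<Longrightarrow> v m + N * i \<in> \<Gamma>"
  unfolding \<Gamma>_def by blast

text \<open>Pigeonhole: \<open>N\<close> distinct residues modulo \<open>N\<close> exhaust all
  residues.\<close>

lemma residue_ex: "\<exists>m<N. v m mod N = n mod N"
proof -
  have "(\<lambda>m. v m mod N) ` {..<N} = {..<N}"
    using N_pos by (intro endo_inj_surj) (auto intro!: inj_onI v_distinct)
  then have "n mod N \<in> (\<lambda>m. v m mod N) ` {..<N}" using N_pos by simp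
  then obtain m where "m < N" "n mod N = v m mod N" by (elim imageE) simp
  then show ?thesis by (intro exI[of _ m]) simp
qed

text \<open>A gap lies a positive number of steps of length \<open>N\<close> below the element
  \<open>v m\<close> of its residue class.\<close>

lemma gap_iff: "n \<notin> \<Gamma> \<longleftrightarrow> (\<exists>m<N. \<exists>j. v m = n + N * (j + 1))"
proof
  assume gap: "n \<notin> \<Gamma>"
  obtain m where m: "m < N" "v m mod N = n mod N" using residue_ex by blast
  have "n < v m"
  proof (rule ccontr)
    assume "\<not> n < v m"
    then have "N dvd n - v m" using m(2) mod_eq_dvd_iff_nat[of "v m" n N] by (simp add: eq_commute)
    then obtain i where "n - v m = N * i" by (auto elim: dvdE)
    then have "n = v m + N * i" using \<open>\<not> n < v m\<close> by simp
    then show False using gap in_\<Gamma>[OF m(1)] by simp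
  qed
  then have "N dvd v m - n" using m(2) mod_eq_dvd_iff_nat[of n "v m" N] by simp
  then obtain j where j: "v m - n = N * j" by (auto elim: dvdE)
  then have "j \<noteq> 0" using \<open>n < v m\<close> by (cases j) auto
  then have "v m = n + N * ((j - 1) + 1)" using j \<open>n < v m\<close> by simp
  then show "\<exists>m<N. \<exists>j. v m = n + N * (j + 1)" using m(1) by blast
next
  assume "\<exists>m<N. \<exists>j. v m = n + N * (j + 1)"
  then obtain m j where m: "m < N" "v m = n + N * (j + 1)" by blast
  show "n \<notin> \<Gamma>"
  proof
    assume "n \<in> \<Gamma>"
    then obtain m' i where m': "m' < N" "n = v m' + N * i" by (auto simp: \<Gamma>_def)
    then have "v m = v m' + N * (i + j + 1)" using m by (simp add: algebra_simps)
    then have "v m mod N = v m' mod N" by (simp only: mod_mult_self2)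
    then have "m = m'" using v_distinct m m' by blast
    then show False using m m' N_pos by simp
  qed
qed

lemma cond_le_imp_in_\<Gamma>: "cond \<le> n \<Longrightarrow> n \<in> \<Gamma>"
proof (rule ccontr)
  assume n: "cond \<le> n" "n \<notin> \<Gamma>"
  then obtain m j where m: "m < N" "v m = n + N * (j + 1)" by (auto simp: gap_iff)
  then have "n + N \<le> v (N - 1)" using v_le[of m] by simp
  then show False using n by (simp add: cond_def)
qed

lemma cond_minus_1_gap: "0 < cond \<Longrightarrow> cond - 1 \<notin> \<Gamma>"
  unfolding gap_iff using N_pos
  by (intro exI[of _ "N - 1"] conjI exI[of _ 0]) (auto simp: cond_def)

lemma less_d_iff: "m < N \<Longrightarrow> i < d m \<longleftrightarrow> v m + N * i < cond"
proof -
  assume m: "m < N"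
  have "i < d m \<longleftrightarrow> Suc i \<le> v (N - 1 - m) div N" by (auto simp: d_def)
  also have "\<dots> \<longleftrightarrow> Suc i * N \<le> v (N - 1 - m)"
    by (rule less_eq_div_iff_mult_less_eq[OF N_pos])
  also have "\<dots> \<longleftrightarrow> v m + N * i < cond"
    using v_symmetric[OF m] by (auto simp: cond_def mult.commute)
  finally show ?thesis .
qed

text \<open>Row \<open>m\<close> enumerates the gaps in the class of \<open>v (N - 1 - m)\<close>:
  its box in column \<open>j\<close> goes to the gap \<open>j + 1\<close> steps below that
  element.\<close>

lemma bij_betw_diagram_gaps:
  "bij_betw (\<lambda>(m, j). v (N - 1 - m) - N * (j + 1)) \<Lambda> (- \<Gamma>)"
proof -
  have val: "v (N - 1 - m) = (v (N - 1 - m) - N * (j + 1)) + N * (j + 1)" if "(m, j) \<in> \<Lambda>" for m j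
  proof -
    have "Suc j * N \<le> v (N - 1 - m)"
      using that less_eq_div_iff_mult_less_eq[OF N_pos, of "Suc j" "v (N - 1 - m)"]
      by (simp add: mem_diagram d_def Suc_le_eq)
    then show ?thesis by (simp add: mult.commute)
  qed
  show ?thesis
  proof (rule bij_betw_imageI)
    show "inj_on (\<lambda>(m, j). v (N - 1 - m) - N * (j + 1)) \<Lambda>"
    proof (rule inj_onI, clarify)
      fix m j m' j'
      assume m: "(m, j) \<in> \<Lambda>" "(m', j') \<in> \<Lambda>"
        and eq: "v (N - 1 - m) - N * (j + 1) = v (N - 1 - m') - N * (j' + 1)"
      define g where "g = v (N - 1 - m) - N * (j + 1)"
      have v: "v (N - 1 - m) = g + N * (j + 1)" "v (N - 1 - m') = g + N * (j' + 1)"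
        using val[OF m(1)] val[OF m(2)] eq by (simp_all only: g_def)
      have "v (N - 1 - m) mod N = v (N - 1 - m') mod N" by (simp only: v mod_mult_self2)
      then have "N - 1 - m = N - 1 - m'" by (rule v_distinct[rotated 2]) (use N_pos in simp_all)
      then have "m = m'" using m by (auto simp: mem_diagram)
      moreover from this have "j = j'" using v N_pos by simp
      ultimately show "m = m' \<and> j = j'" by simp
    qed
  next
    show "(\<lambda>(m, j). v (N - 1 - m) - N * (j + 1)) ` \<Lambda> = - \<Gamma>"
    proof (intro set_eqI iffI)
      fix n assume "n \<in> (\<lambda>(m, j). v (N - 1 - m) - N * (j + 1)) ` \<Lambda>"
      then obtain m j where m: "(m, j) \<in> \<Lambda>" "n = v (N - 1 - m) - N * (j + 1)" by auto
      then have "v (N - 1 - m) = n + N * (j + 1)" using val by simp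
      then have "n \<notin> \<Gamma>" unfolding gap_iff using N_pos by (intro exI[of _ "N - 1 - m"]) auto
      then show "n \<in> - \<Gamma>" by simp
    next
      fix n assume "n \<in> - \<Gamma>"
      then obtain m j where m: "m < N" "v m = n + N * (j + 1)" by (auto simp: gap_iff)
      have "Suc j \<le> v m div N"
        using m by (subst less_eq_div_iff_mult_less_eq[OF N_pos]) simp
      then have "(N - 1 - m, j) \<in> \<Lambda>" using m by (simp add: mem_diagram d_def Suc_le_eq)
      moreover have "n = v (N - 1 - (N - 1 - m)) - N * (j + 1)" using m by simp
      ultimately show "n \<in> (\<lambda>(m, j). v (N - 1 - m) - N * (j + 1)) ` \<Lambda>" by force
    qed
  qed
qed

lemma card_gaps: "card (- \<Gamma>) = card \<Lambda>"
  using bij_betw_same_card[OF bij_betw_diagram_gaps] by simp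

lemma finite_gaps: "finite (- \<Gamma>)"
  by (rule finite_subset[of _ "{..<cond}"]) (auto simp: not_le[symmetric] intro: cond_le_imp_in_\<Gamma>)

end

section \<open>Expansion in series with one member of each order\<close>

fun triangular_coeff :: "(nat \<Rightarrow> 'a::field fps) \<Rightarrow> 'a fps \<Rightarrow> nat \<Rightarrow> 'a" where
  "triangular_coeff \<beta> u k = (u $ k - (\<Sum>n<k. triangular_coeff \<beta> u n * \<beta> n $ k)) / \<beta> k $ k"

declare triangular_coeff.simps [simp del]

lemma fps_triangular_expansion:
  fixes \<beta> :: "nat \<Rightarrow> 'a::field fps"
  assumes diag: "\<And>n. \<beta> n $ n \<noteq> 0"
  shows "u $ k = (\<Sum>n\<le>k. triangular_coeff \<beta> u n * \<beta> n $ k)"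
proof -
  have "triangular_coeff \<beta> u k * \<beta> k $ k = u $ k - (\<Sum>n<k. triangular_coeff \<beta> u n * \<beta> n $ k)"
    using diag[of k] by (subst triangular_coeff.simps) simp
  then show ?thesis by (simp add: lessThan_Suc_atMost[symmetric])
qed

locale apery_basis = apery +
  fixes E :: "nat \<Rightarrow> 'a::field fps"
  assumes E_lead: "\<And>m. m < N \<Longrightarrow> E m $ v m \<noteq> 0"
    and E_below: "\<And>m k. m < N \<Longrightarrow> k < v m \<Longrightarrow> E m $ k = 0"
begin

text \<open>The coefficients are series in \<open>z^N\<close>, the image of y, so \<open>M\<close>
  is the module over these series spanned by the \<open>E m\<close>.\<close>

definition lincomb :: "(nat \<Rightarrow> 'a fps) \<Rightarrow> 'a fps" where
  "lincomb a = (\<Sum>m<N. (a m oo fps_X ^ N) * E m)"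

definition M :: "'a fps set" where
  "M = range lincomb"

lemma shift_E_nth:
  assumes "m < N"
  shows "k < v m + N * i \<Longrightarrow> (fps_X ^ (N * i) * E m) $ k = 0"
    and "(fps_X ^ (N * i) * E m) $ (v m + N * i) \<noteq> 0"
  using E_lead[OF assms] E_below[OF assms] by (auto simp: fps_X_power_mult_nth)

lemma lincomb_nth:
  "lincomb a $ k = (\<Sum>(m, i)\<in>{..<N} \<times> {..k}. a m $ i * (fps_X ^ (N * i) * E m) $ k)"
proof -
  have X: "(fps_X ^ N :: 'a fps) $ 0 = 0" using N_pos by simp
  have "((a m oo fps_X ^ N) * E m) $ k = (\<Sum>i\<le>k. a m $ i * (fps_X ^ (N * i) * E m) $ k)" for m
  proof -
    have "(a m oo fps_X ^ N) $ l = (\<Sum>i\<le>k. fps_const (a m $ i) * fps_X ^ (N * i)) $ l" if "l \<le> k" for l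
    proof -
      have "(a m oo fps_X ^ N) $ l = (\<Sum>i\<le>l. a m $ i * (fps_X ^ (N * i)) $ l)"
        by (simp add: fps_compose_nth power_mult atLeast0AtMost)
      also have "\<dots> = (\<Sum>i\<le>k. a m $ i * (fps_X ^ (N * i)) $ l)"
        using that N_pos by (intro sum.mono_neutral_left) auto
      finally show ?thesis by (simp add: fps_sum_nth)
    qed
    then have "((a m oo fps_X ^ N) * E m) $ k
        = ((\<Sum>i\<le>k. fps_const (a m $ i) * fps_X ^ (N * i)) * E m) $ k"
      by (intro fps_mult_nth_cong) auto
    also have "\<dots> = (\<Sum>i\<le>k. a m $ i * (fps_X ^ (N * i) * E m) $ k)"
      by (simp add: sum_distrib_right fps_sum_nth mult.assoc)
    finally show ?thesis .
  qed
  then show ?thesis by (simp add: lincomb_def fps_sum_nth sum.cartesian_product)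
qed

lemma lincomb_diff: "lincomb a - lincomb b = lincomb (\<lambda>m. a m - b m)"
  by (simp add: lincomb_def fps_compose_sub_distrib algebra_simps sum_subtractf)

lemma lincomb_add: "lincomb a + lincomb b = lincomb (\<lambda>m. a m + b m)"
  by (simp add: lincomb_def fps_compose_add_distrib algebra_simps sum.distrib)

lemma M_diff: "u \<in> M \<Longrightarrow> w \<in> M \<Longrightarrow> u - w \<in> M"
  unfolding M_def by (auto simp: lincomb_diff)

lemma M_add: "u \<in> M \<Longrightarrow> w \<in> M \<Longrightarrow> u + w \<in> M"
  unfolding M_def by (auto simp: lincomb_add)

lemma index_unique:
  assumes "m < N" "m' < N" "v m + N * i = v m' + N * i'"
  shows "m = m' \<and> i = i'"
proof -
  have "v m mod N = v m' mod N" using assms(3) by (metis mod_mult_self2)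
  then have "m = m'" using v_distinct assms by blast
  then show ?thesis using assms(3) N_pos by simp
qed

text \<open>The shifted \<open>E m\<close> have pairwise distinct orders, so lowest terms cannot
  cancel; the coefficients vanish one by one in increasing order of
  \<open>v m + N * i\<close>.\<close>

lemma lincomb_vanish:
  assumes z: "\<And>k. k < n \<Longrightarrow> lincomb a $ k = 0" and "m < N" "v m + N * i < n"
  shows "a m $ i = 0"
  using assms(2,3)
proof (induction "v m + N * i" arbitrary: m i rule: less_induct)
  case less
  let ?k = "v m + N * i"
  have "i \<le> ?k" using N_pos by (cases N) auto
  have other: "a m' $ i' * (fps_X ^ (N * i') * E m') $ ?k = 0" if m': "m' < N" "(m', i') \<noteq> (m, i)" for m' i'
  proof -
    have "v m' + N * i' \<noteq> ?k" using index_unique[of m' m i' i] m' less.prems by auto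
    then consider "v m' + N * i' < ?k" | "?k < v m' + N * i'" by linarith
    then show ?thesis
    proof cases
      case 1
      then show ?thesis using less.hyps[OF 1 m'(1)] less.prems by simp
    qed (simp add: shift_E_nth(1)[OF m'(1)])
  qed
  then have "lincomb a $ ?k = (\<Sum>(m, i)\<in>{(m, i)}. a m $ i * (fps_X ^ (N * i) * E m) $ ?k)"
    unfolding lincomb_nth using less.prems \<open>i \<le> ?k\<close>
    by (intro sum.mono_neutral_right) (auto simp del: mult_eq_0_iff intro!: other)
  then show ?case using z[OF less.prems(2)] shift_E_nth(2)[OF less.prems(1), of i] by simp
qed

text \<open>If the order were a gap, each term of the combination would either start beyond it or
  have a zero coefficient by \<open>lincomb_vanish\<close>.\<close>

lemma subdegree_in_\<Gamma>:
  assumes "u \<in> M" "u \<noteq> 0"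
  shows "subdegree u \<in> \<Gamma>"
proof (rule ccontr)
  assume gap: "subdegree u \<notin> \<Gamma>"
  obtain a where u: "u = lincomb a" using assms by (auto simp: M_def)
  have z: "lincomb a $ k = 0" if "k < subdegree u" for k
    using nth_less_subdegree_zero[OF that] by (simp only: u)
  have "a m $ i * (fps_X ^ (N * i) * E m) $ subdegree u = 0" if m: "m < N" for m i
  proof -
    have "v m + N * i \<noteq> subdegree u" using in_\<Gamma>[OF m, of i] gap by auto
    then consider "v m + N * i < subdegree u" | "subdegree u < v m + N * i" by linarith
    then show ?thesis
    proof cases
      case 1
      then show ?thesis using lincomb_vanish[OF z m] by simp
    qed (simp add: shift_E_nth(1)[OF m])
  qed
  then have "lincomb a $ subdegree u = 0" unfolding lincomb_nth by (intro sum.neutral) (auto simp del: mult_eq_0_iff)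
  then show False using assms(2) by (simp flip: u)
qed

text \<open>Completes the basis of \<open>M\<close> to a triangular basis of all power series, so
  the powers at gaps span the quotient. The second clause puts the series vanishing below
  \<open>cond\<close> inside \<open>M\<close>.\<close>

lemma expansion:
  fixes u :: "'a fps"
  shows "\<exists>\<gamma>. u - (\<Sum>g\<in>- \<Gamma>. fps_const (\<gamma> g) * fps_X ^ g) \<in> M \<and>
      ((\<forall>k<cond. u $ k = 0) \<longrightarrow> (\<forall>g\<in>- \<Gamma>. \<gamma> g = 0))"
proof -
  define \<mu> where "\<mu> n = (SOME m. m < N \<and> v m mod N = n mod N)" for n
  \<comment> \<open>Orders in \<open>\<Gamma>\<close> are filled by shifted \<open>E m\<close>, gaps
    by powers of z; every order then occurs exactly once.\<close>
  define \<beta> where "\<beta> n = (if n \<in> \<Gamma> then fps_X ^ (n - v (\<mu> n)) * E (\<mu> n) else fps_X ^ n)" for n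
  have \<mu>: "\<mu> n < N" "v (\<mu> n) mod N = n mod N" for n
    using someI_ex[OF residue_ex, of n] unfolding \<mu>_def by blast+
  have \<mu>_eq: "\<mu> (v m + N * i) = m" if "m < N" for m i
    by (rule v_distinct) (use \<mu>[of "v m + N * i"] that in simp_all)
  have \<beta>_\<Gamma>: "\<beta> (v m + N * i) = fps_X ^ (N * i) * E m" if "m < N" for m i
    using that by (simp add: \<beta>_def in_\<Gamma> \<mu>_eq)
  have lead: "\<beta> n $ n \<noteq> 0 \<and> (\<forall>k<n. \<beta> n $ k = 0)" for n
  proof (cases "n \<in> \<Gamma>")
    case True
    then obtain m i where m: "m < N" "n = v m + N * i" by (auto simp: \<Gamma>_def)
    show ?thesis unfolding m(2) \<beta>_\<Gamma>[OF m(1)] using shift_E_nth[OF m(1)] by blast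
  qed (auto simp: \<beta>_def)
  then have diag: "\<beta> n $ n \<noteq> 0" and below: "k < n \<Longrightarrow> \<beta> n $ k = 0" for n k by auto
  obtain \<gamma> where \<gamma>: "\<And>k. u $ k = (\<Sum>n\<le>k. \<gamma> n * \<beta> n $ k)"
    using fps_triangular_expansion[of \<beta> u, OF diag] by blast
  have "u - (\<Sum>g\<in>- \<Gamma>. fps_const (\<gamma> g) * fps_X ^ g) = lincomb (\<lambda>m. Abs_fps (\<lambda>i. \<gamma> (v m + N * i)))"
    (is "_ = lincomb ?a")
  proof (rule fps_ext)
    fix k
    have inj: "inj_on (\<lambda>(m, i). v m + N * i) ({..<N} \<times> {..k})"
    proof (rule inj_onI)
      fix x y
      assume "x \<in> {..<N} \<times> {..k}" "y \<in> {..<N} \<times> {..k}"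
        "(case x of (m, i) \<Rightarrow> v m + N * i) = (case y of (m, i) \<Rightarrow> v m + N * i)"
      then show "x = y"
        using index_unique[of "fst x" "fst y" "snd x" "snd y"]
        by (simp add: case_prod_unfold prod_eq_iff mem_Times_iff)
    qed
    have "lincomb ?a $ k = (\<Sum>(m, i)\<in>{..<N} \<times> {..k}. \<gamma> (v m + N * i) * \<beta> (v m + N * i) $ k)"
      unfolding lincomb_nth by (intro sum.cong) (auto simp: \<beta>_\<Gamma>)
    also have "\<dots> = (\<Sum>n\<in>(\<lambda>(m, i). v m + N * i) ` ({..<N} \<times> {..k}). \<gamma> n * \<beta> n $ k)"
      unfolding sum.reindex[OF inj] by (simp add: o_def case_prod_unfold)
    also have "\<dots> = (\<Sum>n\<in>\<Gamma> \<inter> {..k}. \<gamma> n * \<beta> n $ k)"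
    proof (rule sum.mono_neutral_right)
      show "\<Gamma> \<inter> {..k} \<subseteq> (\<lambda>(m, i). v m + N * i) ` ({..<N} \<times> {..k})"
      proof
        fix n assume "n \<in> \<Gamma> \<inter> {..k}"
        then obtain m i where m: "m < N" "n = v m + N * i" "n \<le> k" by (auto simp: \<Gamma>_def)
        then have "i \<le> k" using N_pos by (cases N) auto
        then show "n \<in> (\<lambda>(m, i). v m + N * i) ` ({..<N} \<times> {..k})" using m by force
      qed
      show "\<forall>n\<in>(\<lambda>(m, i). v m + N * i) ` ({..<N} \<times> {..k}) - \<Gamma> \<inter> {..k}. \<gamma> n * \<beta> n $ k = 0"
      proof
        fix n assume n: "n \<in> (\<lambda>(m, i). v m + N * i) ` ({..<N} \<times> {..k}) - \<Gamma> \<inter> {..k}"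
        then have "n \<in> \<Gamma>" by (auto simp: in_\<Gamma>)
        then show "\<gamma> n * \<beta> n $ k = 0" using n below[of k n] by simp
      qed
    qed auto
    finally have comb: "lincomb ?a $ k = (\<Sum>n\<in>\<Gamma> \<inter> {..k}. \<gamma> n * \<beta> n $ k)" .
    have "(\<Sum>g\<in>- \<Gamma>. fps_const (\<gamma> g) * fps_X ^ g) $ k = (\<Sum>g\<in>- \<Gamma>. \<gamma> g * \<beta> g $ k)"
      unfolding fps_sum_nth by (intro sum.cong) (auto simp: \<beta>_def)
    also have "\<dots> = (\<Sum>g\<in>- \<Gamma> \<inter> {..k}. \<gamma> g * \<beta> g $ k)"
      using finite_gaps
    proof (rule sum.mono_neutral_right)
      show "\<forall>n\<in>- \<Gamma> - - \<Gamma> \<inter> {..k}. \<gamma> n * \<beta> n $ k = 0"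
      proof
        fix n assume "n \<in> - \<Gamma> - - \<Gamma> \<inter> {..k}"
        then have "\<not> n \<le> k" by blast
        then show "\<gamma> n * \<beta> n $ k = 0" using below[of k n] by simp
      qed
    qed auto
    finally have gaps: "(\<Sum>g\<in>- \<Gamma>. fps_const (\<gamma> g) * fps_X ^ g) $ k = (\<Sum>g\<in>- \<Gamma> \<inter> {..k}. \<gamma> g * \<beta> g $ k)" .
    have "u $ k = (\<Sum>n\<in>(\<Gamma> \<inter> {..k}) \<union> (- \<Gamma> \<inter> {..k}). \<gamma> n * \<beta> n $ k)"
      unfolding \<gamma> by (intro sum.cong) auto
    also have "\<dots> = (\<Sum>n\<in>\<Gamma> \<inter> {..k}. \<gamma> n * \<beta> n $ k) + (\<Sum>g\<in>- \<Gamma> \<inter> {..k}. \<gamma> g * \<beta> g $ k)"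
      by (intro sum.union_disjoint) auto
    finally show "(u - (\<Sum>g\<in>- \<Gamma>. fps_const (\<gamma> g) * fps_X ^ g)) $ k = lincomb ?a $ k"
      by (simp add: comb gaps)
  qed
  moreover have "\<gamma> g = 0" if u: "\<forall>k<cond. u $ k = 0" and g: "g \<in> - \<Gamma>" for g
  proof -
    \<comment> \<open>Triangularity forces the coefficients below \<open>cond\<close> to vanish one
      after another, and all gaps are below \<open>cond\<close>.\<close>
    have "\<gamma> n = 0" if n: "n < cond" for n
      using n
    proof (induction n rule: less_induct)
      case (less n)
      have "u $ n = (\<Sum>k\<in>{n}. \<gamma> k * \<beta> k $ n)"
        unfolding \<gamma> using less by (intro sum.mono_neutral_right) auto
      then show ?case using u less.prems diag[of n] by simp
    qed
    moreover have "g < cond" using cond_le_imp_in_\<Gamma>[of g] g by (auto simp: not_le[symmetric])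
    ultimately show ?thesis by simp
  qed
  ultimately show ?thesis unfolding M_def by (intro exI[of _ \<gamma>]) auto
qed

lemma cond_in_M:
  assumes "\<And>k. k < cond \<Longrightarrow> u $ k = 0"
  shows "u \<in> M"
proof -
  obtain \<gamma> where "u - (\<Sum>g\<in>- \<Gamma>. fps_const (\<gamma> g) * fps_X ^ g) \<in> M" "\<forall>g\<in>- \<Gamma>. \<gamma> g = 0"
    using expansion[of u] assms by blast
  then show ?thesis by simp
qed

lemma conductor_M: "conductor M = {u. \<forall>k<cond. u $ k = 0}"
  unfolding conductor_def
proof (rule Greatest_equality)
  have mult: "(c * u) $ k = 0" if "\<forall>k<cond. u $ k = 0" "k < cond" for c u :: "'a fps" and k
    using fps_mult_nth_zero[of 0 c cond u k] that by auto
  then show "ideal_of UNIV {u :: 'a fps. \<forall>k<cond. u $ k = 0} \<and> {u. \<forall>k<cond. u $ k = 0} \<subseteq> M"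
    by (auto simp: ideal_of_def intro: cond_in_M)
next
  fix I assume I: "ideal_of UNIV I \<and> I \<subseteq> M"
  show "I \<le> {u. \<forall>k<cond. u $ k = 0}"
  proof (rule ccontr)
    assume "\<not> I \<le> {u. \<forall>k<cond. u $ k = 0}"
    then obtain u k where u: "u \<in> I" "k < cond" "u $ k \<noteq> 0" by auto
    then have "u \<noteq> 0" "subdegree u \<le> k" by (auto intro: subdegree_leI)
    \<comment> \<open>The power of z raises the order to \<open>cond - 1\<close>, the largest gap,
      without leaving the ideal.\<close>
    let ?w = "fps_X ^ (cond - 1 - subdegree u) * u"
    have "?w \<in> M" using I u(1) ideal_of_mult_UNIV by blast
    moreover have "subdegree ?w = cond - 1" "?w \<noteq> 0"
      using \<open>u \<noteq> 0\<close> \<open>subdegree u \<le> k\<close> u(2) by (auto simp: fps_X_power_subdegree)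
    ultimately have "cond - 1 \<in> \<Gamma>" using subdegree_in_\<Gamma> by metis
    then show False using cond_minus_1_gap u(2) by auto
  qed
qed

text \<open>The powers of z at gaps form a basis: a nonzero combination of them has a gap as its
  order, hence is not in \<open>M\<close>.\<close>

lemma has_delta_M: "has_delta M (card \<Lambda>)"
  unfolding has_delta_def
proof (rule quot_dimI[where S = "- \<Gamma>" and b = "\<lambda>g. fps_X ^ g"])
  show "\<exists>c. u - (\<Sum>g\<in>- \<Gamma>. scale_z (c g) (fps_X ^ g)) \<in> M" for u
    using expansion[of u] by (auto simp: scale_z_def)
  fix c :: "nat \<Rightarrow> 'a" and g
  assume sum: "(\<Sum>g\<in>- \<Gamma>. scale_z (c g) (fps_X ^ g)) \<in> M" (is "?u \<in> M") and g: "g \<in> - \<Gamma>"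
  have nth: "?u $ k = (if k \<in> \<Gamma> then 0 else c k)" for k
  proof -
    have "?u $ k = (\<Sum>g\<in>- \<Gamma>. if g = k then c g else 0)"
      unfolding fps_sum_nth scale_z_def by (intro sum.cong) auto
    then show ?thesis using finite_gaps by simp
  qed
  show "c g = 0"
  proof (rule ccontr)
    assume "c g \<noteq> 0"
    then have "?u \<noteq> 0" using nth[of g] g by auto
    then have "subdegree ?u \<in> \<Gamma>" "?u $ subdegree ?u \<noteq> 0" using subdegree_in_\<Gamma>[OF sum] by auto
    then show False using nth by auto
  qed
qed (auto simp: finite_gaps card_gaps scale_z_def algebra_simps intro: M_diff simp flip: fps_const_sub)

end

section \<open>The maximal ideal and the multiplicity\<close>

context apery_basis
begin

lemma M_zero: "0 \<in> M"
  by (rule cond_in_M) simp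

text \<open>The least positive element of \<open>\<Gamma>\<close> is \<open>N\<close>, because
  \<open>v_step\<close> puts all \<open>v m\<close> with \<open>m > 0\<close> at or above
  it.\<close>

lemma vanish_below_N:
  assumes "u \<in> M" "u $ 0 = 0" "k < N"
  shows "u $ k = 0"
proof (cases "u = 0")
  case False
  then obtain m i where m: "m < N" "subdegree u = v m + N * i"
    using subdegree_in_\<Gamma>[OF assms(1)] by (auto simp: \<Gamma>_def)
  have "subdegree u \<noteq> 0" using False assms(2) by (simp add: subdegree_eq_0_iff)
  have "N \<le> subdegree u"
  proof (cases "m = 0")
    case True
    then have "i \<noteq> 0" using m \<open>subdegree u \<noteq> 0\<close> v_0 by auto
    then show ?thesis using m by (cases i) auto
  next
    case False
    then show ?thesis using v_step[of 0 m] v_0 m by simp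
  qed
  then show ?thesis using assms(3) by (intro nth_less_subdegree_zero) simp
qed simp

lemma base_series_in_M:
  assumes "E 0 = 1"
  shows "w oo fps_X ^ N \<in> M"
proof -
  have "lincomb (\<lambda>m. if m = 0 then w else 0) = (\<Sum>m<N. if m = 0 then w oo fps_X ^ N else 0)"
    unfolding lincomb_def by (intro sum.cong) (auto simp: assms)
  also have "\<dots> = w oo fps_X ^ N" using N_pos by simp
  finally show ?thesis unfolding M_def by (metis rangeI)
qed

lemma const_in_M: "E 0 = 1 \<Longrightarrow> fps_const c \<in> M"
  using base_series_in_M[of "fps_const c"] by simp

text \<open>After scaling, the inverse is a geometric series in \<open>w\<close>. It can be cut off
  after \<open>cond\<close> terms, since the remainder falls into the conductor.\<close>

lemma inverse_in_M:
  assumes E_0: "E 0 = 1" and mult: "\<And>u w. u \<in> M \<Longrightarrow> w \<in> M \<Longrightarrow> u * w \<in> M"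
    and u: "u \<in> M" "u $ 0 \<noteq> 0"
  shows "inverse u \<in> M"
proof -
  define c where "c = fps_const (inverse (u $ 0))"
  define w where "w = 1 - c * u"
  have one: "1 \<in> M" using const_in_M[OF E_0, of 1] by simp
  have c: "c \<in> M" unfolding c_def using const_in_M[OF E_0] .
  have w: "w \<in> M" "w $ 0 = 0" unfolding w_def using one c u by (auto intro: M_diff mult simp: c_def)
  have pow: "w ^ k \<in> M" for k by (induction k) (auto intro: one mult w)
  have "(\<Sum>k<n. w ^ k) \<in> M" for n by (induction n) (auto intro: M_zero M_add pow)
  then have "c * (\<Sum>k<cond. w ^ k) \<in> M" using mult c by blast
  moreover have "inverse u * w ^ cond \<in> M"
    using startsby_zero_power_prefix[OF w(2)] fps_mult_nth_zero[of 0 "inverse u" cond "w ^ cond"]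
    by (intro cond_in_M) auto
  moreover have "inverse u = c * (\<Sum>k<cond. w ^ k) + inverse u * w ^ cond"
  proof -
    have "u * inverse u = 1" using u(2) by (simp add: inverse_mult_eq_1')
    have "1 - w ^ cond = c * u * (\<Sum>k<cond. w ^ k)"
      unfolding one_diff_power_eq by (simp add: w_def)
    then have "inverse u * (1 - w ^ cond) = (u * inverse u) * (c * (\<Sum>k<cond. w ^ k))"
      by (simp add: mult_ac)
    then show ?thesis by (simp add: \<open>u * inverse u = 1\<close> algebra_simps)
  qed
  ultimately show ?thesis using M_add by metis
qed

text \<open>Elements of \<open>M\<close> with nonzero constant term are units of \<open>M\<close>,
  so every proper ideal consists of series without constant term.\<close>

lemma max_ideal_M:
  assumes E_0: "E 0 = 1" and mult: "\<And>u w. u \<in> M \<Longrightarrow> w \<in> M \<Longrightarrow> u * w \<in> M"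
  shows "max_ideal M = {u \<in> M. u $ 0 = 0}" (is "_ = ?Z")
proof -
  have one: "1 \<in> M" using const_in_M[OF E_0, of 1] by simp
  have Z: "ideal_of M ?Z" by (auto simp: ideal_of_def M_zero intro: mult M_add)
  have "?Z \<noteq> M" using one by force
  have full: "J = M" if J: "ideal_of M J" and u: "u \<in> J" "u $ 0 \<noteq> 0" for J u
  proof -
    have "u \<in> M" using ideal_of_subset[OF J] u(1) by blast
    then have "inverse u * u \<in> J"
      using J u inverse_in_M[OF E_0 mult] by (intro ideal_of_mult) auto
    then have "1 \<in> J" using u(2) by (simp add: inverse_mult_eq_1)
    then have "w \<in> J" if "w \<in> M" for w using ideal_of_mult[OF J that, of 1] by simp
    then show ?thesis using ideal_of_subset[OF J] by blast
  qed
  then have proper: "J \<subseteq> ?Z" if "ideal_of M J" "J \<noteq> M" for J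
    using that ideal_of_subset[of M J] by blast
  show ?thesis
    unfolding max_ideal_def
  proof (rule the_equality)
    show "ideal_of M ?Z \<and> ?Z \<noteq> M \<and> (\<forall>J. ideal_of M J \<and> ?Z \<subseteq> J \<and> J \<noteq> M \<longrightarrow> J = ?Z)"
      using Z \<open>?Z \<noteq> M\<close> proper by blast
    fix J assume J: "ideal_of M J \<and> J \<noteq> M \<and> (\<forall>J'. ideal_of M J' \<and> J \<subseteq> J' \<and> J' \<noteq> M \<longrightarrow> J' = J)"
    then have "J \<subseteq> ?Z" using proper by blast
    then show "J = ?Z" using J Z \<open>?Z \<noteq> M\<close> by metis
  qed
qed

text \<open>The maximal ideal contains \<open>z^N\<close> and nothing of smaller order, so it
  generates the ideal of \<open>z^N\<close> in the full power series ring.\<close>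

lemma has_multiplicity_M:
  assumes E_0: "E 0 = 1" and mult: "\<And>u w. u \<in> M \<Longrightarrow> w \<in> M \<Longrightarrow> u * w \<in> M"
  shows "has_multiplicity M N"
proof -
  let ?W = "{u :: 'a fps. \<forall>k<N. u $ k = 0}"
  have "ideal_gen (max_ideal M) = ?W"
  proof
    have "(c * u) $ k = 0" if "\<forall>k<N. u $ k = 0" "k < N" for c u :: "'a fps" and k
      using fps_mult_nth_zero[of 0 c N u k] that by auto
    then have "ideal_of UNIV ?W" by (auto simp: ideal_of_def)
    then show "ideal_gen (max_ideal M) \<subseteq> ?W"
      by (intro ideal_gen_minimal) (auto simp: max_ideal_M[OF assms] vanish_below_N)
    show "?W \<subseteq> ideal_gen (max_ideal M)"
    proof
      fix u assume u: "u \<in> ?W"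
      have "fps_X ^ N \<in> max_ideal M"
        using base_series_in_M[OF E_0, of fps_X] N_pos by (simp add: max_ideal_M[OF assms])
      then have "fps_X ^ N \<in> ideal_gen (max_ideal M)" by (rule subsetD[OF ideal_gen_superset])
      then have "fps_shift N u * fps_X ^ N \<in> ideal_gen (max_ideal M)"
        by (intro ideal_of_mult_UNIV ideal_of_ideal_gen)
      moreover have "u = fps_shift N u * fps_X ^ N"
        using u by (intro fps_ext) (auto simp: fps_X_power_mult_right_nth)
      ultimately show "u \<in> ideal_gen (max_ideal M)" by simp
    qed
  qed
  moreover have "quot_dim scale_z UNIV ?W N"
  proof (rule quot_dimI[where S = "{..<N}" and b = "\<lambda>k. fps_X ^ k"])
    have nth: "(\<Sum>t<N. scale_z (c t) (fps_X ^ t)) $ k = (if k < N then c k else 0)" for c :: "nat \<Rightarrow> 'a" and k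
    proof -
      have "(\<Sum>t<N. scale_z (c t) (fps_X ^ t)) $ k = (\<Sum>t<N. if t = k then c t else 0)"
        unfolding fps_sum_nth scale_z_def by (intro sum.cong) auto
      then show ?thesis by simp
    qed
    show "\<exists>c. u - (\<Sum>t<N. scale_z (c t) (fps_X ^ t)) \<in> ?W" for u
      by (intro exI[of _ "\<lambda>k. u $ k"]) (simp add: nth)
    show "c t = 0" if "(\<Sum>t<N. scale_z (c t) (fps_X ^ t)) \<in> ?W" "t \<in> {..<N}" for c t
      using that by (simp add: nth)
  qed (auto simp: scale_z_def algebra_simps simp flip: fps_const_sub)
  ultimately show ?thesis by (simp add: has_multiplicity_def)
qed

end

section \<open>The plane curve singularity\<close>

lemma cong_mult_cancel_less:
  fixes a b n k :: nat
  assumes "coprime n k" "k * a mod n = k * b mod n" "a < n" "b < n"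
  shows "a = b"
proof -
  have "[k * a = k * b] (mod n)" using assms(2) by (simp add: cong_def)
  then have "[a = b] (mod n)" using assms(1) by (simp add: cong_mult_lcancel_nat coprime_commute)
  then show ?thesis using assms(3,4) by (simp add: cong_def)
qed

locale curve =
  fixes r s \<upsilon> p :: nat
  assumes s_less: "s < r" and s_pos: "1 \<le> s" and \<upsilon>_pos: "1 \<le> \<upsilon>" and p_pos: "1 \<le> p"
    and coprime_rs: "coprime r s" and coprime_\<upsilon>p: "coprime \<upsilon> p"
begin

definition val :: "nat \<Rightarrow> nat" where
  "val m = \<upsilon> * r * m + p * (m div s)"

lemma div_less: "m < \<upsilon> * s \<Longrightarrow> m div s < \<upsilon>"
  by (simp add: less_mult_imp_div_less)

text \<open>Modulo \<open>\<upsilon>\<close> only the summand with \<open>p\<close> remains and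
  determines \<open>m div s\<close>. After removing it and cancelling \<open>\<upsilon>\<close>, the
  residue modulo \<open>s\<close> determines \<open>m mod s\<close>.\<close>

lemma val_distinct:
  assumes m: "m < \<upsilon> * s" "m' < \<upsilon> * s" and eq: "val m mod (\<upsilon> * s) = val m' mod (\<upsilon> * s)"
  shows "m = m'"
proof -
  have "val m mod \<upsilon> = val m' mod \<upsilon>" using eq by (metis mod_mult_right_eq mod_mod_cancel dvd_triv_left)
  then have "p * (m div s) mod \<upsilon> = p * (m' div s) mod \<upsilon>"
    by (simp add: val_def mult.assoc)
  then have div: "m div s = m' div s"
    by (rule cong_mult_cancel_less[OF coprime_\<upsilon>p _ div_less[OF m(1)] div_less[OF m(2)]])
  have "[\<upsilon> * r * m = \<upsilon> * r * m'] (mod \<upsilon> * s)"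
    using eq unfolding val_def div cong_def[symmetric] by (simp add: cong_add_rcancel_nat)
  then have "[r * m = r * m'] (mod s)"
    using \<upsilon>_pos by (simp add: mult.assoc cong_def mod_mult_mult1)
  then have "[m = m'] (mod s)" using coprime_rs by (simp add: cong_mult_lcancel_nat)
  then show ?thesis using div by (metis cong_def div_mult_mod_eq)
qed

text \<open>Reflection of \<open>m\<close> complements both digits of \<open>m = q * s + t\<close>:
  \<open>q\<close> in \<open>\<upsilon> - 1\<close> and \<open>t\<close> in
  \<open>s - 1\<close>.\<close>

lemma reflect_decomp:
  assumes "m < \<upsilon> * s"
  shows "(\<upsilon> * s - 1 - m) div s = \<upsilon> - 1 - m div s"
    and "(\<upsilon> * s - 1 - m) mod s = s - 1 - m mod s"
proof -
  define q t where "q = m div s" and "t = m mod s"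
  have m: "m = q * s + t" "t < s" "q < \<upsilon>"
    using s_pos div_less[OF assms] by (auto simp: q_def t_def)
  obtain k where k: "\<upsilon> = q + 1 + k" using m(3) less_imp_Suc_add by auto
  define t' where "t' = s - 1 - t"
  have "t' < s" using s_pos by (simp add: t'_def)
  moreover have "\<upsilon> * s - 1 - m = t' + (\<upsilon> - 1 - q) * s"
    using m by (simp add: k algebra_simps t'_def)
  ultimately have "(\<upsilon> * s - 1 - m) div s = \<upsilon> - 1 - q" "(\<upsilon> * s - 1 - m) mod s = t'"
    by simp_all
  then show "(\<upsilon> * s - 1 - m) div s = \<upsilon> - 1 - m div s" "(\<upsilon> * s - 1 - m) mod s = s - 1 - m mod s"
    by (simp_all only: q_def t_def t'_def)
qed

text \<open>The gaps between successive values are large enough because \<open>s < r\<close>;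
  symmetry holds because the quotients of reflected indices add up to
  \<open>\<upsilon> - 1\<close>.\<close>

sublocale apery "\<upsilon> * s" val
proof
  show "0 < \<upsilon> * s" using \<upsilon>_pos s_pos by simp
  show "m = m'" if "m < \<upsilon> * s" "m' < \<upsilon> * s" "val m mod (\<upsilon> * s) = val m' mod (\<upsilon> * s)" for m m'
    using that by (rule val_distinct)
  fix m m' assume m: "m < m'" "m' < \<upsilon> * s"
  have "\<upsilon> * s \<le> \<upsilon> * r" using s_less by simp
  then have "\<upsilon> * r * m + \<upsilon> * s \<le> \<upsilon> * r * Suc m" by simp
  also have "\<dots> \<le> \<upsilon> * r * m'" using m(1) by (intro mult_le_mono2) simp
  finally have "\<upsilon> * r * m + \<upsilon> * s \<le> \<upsilon> * r * m'" .
  moreover have "p * (m div s) \<le> p * (m' div s)"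
    using m(1) by (intro mult_le_mono2 div_le_mono) simp
  ultimately show "val m + \<upsilon> * s \<le> val m'" unfolding val_def by linarith
next
  fix m assume m: "m < \<upsilon> * s"
  have d0: "(\<upsilon> * s - 1) div s = \<upsilon> - 1" using reflect_decomp(1)[of 0] \<upsilon>_pos s_pos by simp
  have "val m + val (\<upsilon> * s - 1 - m)
      = \<upsilon> * r * (m + (\<upsilon> * s - 1 - m)) + p * (m div s + (\<upsilon> - 1 - m div s))"
    unfolding val_def reflect_decomp(1)[OF m] by (simp only: distrib_left add_ac)
  also have "\<dots> = val (\<upsilon> * s - 1)" unfolding val_def d0 using m div_less[OF m] by simp
  finally show "val m + val (\<upsilon> * s - 1 - m) = val (\<upsilon> * s - 1)" .
qed

lemma d_reflect:
  assumes "b < s"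
  shows "d (\<upsilon> * s - 1 - b) = r * b div s"
proof -
  have "b < \<upsilon> * s" using assms \<upsilon>_pos by (metis less_le_trans mult_le_mono1 nat_mult_1)
  then have "d (\<upsilon> * s - 1 - b) = val b div (\<upsilon> * s)" by (simp add: d_def)
  also have "\<dots> = \<upsilon> * (r * b) div (\<upsilon> * s)" using assms by (simp add: val_def mult.assoc)
  also have "\<dots> = r * b div s" using \<upsilon>_pos by (intro div_mult_mult1) simp
  finally show ?thesis .
qed

text \<open>The reflected index has quotient at least 1 by \<open>s\<close>, so its value contains
  \<open>p\<close> as a summand.\<close>

lemma p_div_le_d:
  assumes "i < (\<upsilon> - 1) * s"
  shows "p div (\<upsilon> * s) \<le> d i"
proof -
  have "s \<le> \<upsilon> * s - 1 - i" using assms by (simp add: diff_mult_distrib)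
  then have "1 \<le> (\<upsilon> * s - 1 - i) div s" using div_le_mono[of s _ s] s_pos by simp
  then have "p * 1 \<le> val (\<upsilon> * s - 1 - i)" unfolding val_def by (intro trans_le_add2 mult_le_mono2)
  then show ?thesis unfolding d_def by (intro div_le_mono) simp
qed

text \<open>The summand with \<open>p\<close> is less than \<open>\<upsilon>\<close>, so it
  disappears when dividing by \<open>\<upsilon>\<close> first and by \<open>s\<close>
  afterwards.\<close>

lemma d_special:
  assumes special: "p = 1 \<or> \<upsilon> = 1" and "m < \<upsilon> * s"
  shows "d m = r * (\<upsilon> * s - 1 - m) div s"
proof -
  let ?b = "\<upsilon> * s - 1 - m"
  have "?b < \<upsilon> * s" using assms(2) by simp
  then have "p * (?b div s) < \<upsilon>" using special div_less[of ?b] by auto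
  then have "val ?b div \<upsilon> = r * ?b" by (simp add: val_def mult.assoc)
  then show ?thesis by (simp add: d_def div_mult2_eq)
qed

lemma diagram_eq_boxes:
  assumes "p = 1 \<or> \<upsilon> = 1"
  shows "\<Lambda> = boxes_above_diagonal (\<upsilon> * s) (\<upsilon> * r)"
proof -
  have N: "0 < \<upsilon> * s" "0 < \<upsilon> * r" using \<upsilon>_pos s_pos s_less by auto
  \<comment> \<open>Over the closed box the linear form is largest at the lower right
    vertex.\<close>
  have box: "{real i..real i + 1} \<times> {real j..real j + 1} \<subseteq> {(a, b). a / real m + b / real n \<le> 1}
      \<longleftrightarrow> (real i + 1) / real m + (real j + 1) / real n \<le> 1" (is "?A \<longleftrightarrow> ?B") for i j m n :: nat
  proof
    assume ?B
    have "a / real m + b / real n \<le> (real i + 1) / real m + (real j + 1) / real n"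
      if "a \<le> real i + 1" "b \<le> real j + 1" for a b
      using that by (intro add_mono divide_right_mono) auto
    then show ?A using \<open>?B\<close> by fastforce
  next
    assume ?A
    moreover have "(real i + 1, real j + 1) \<in> {real i..real i + 1} \<times> {real j..real j + 1}" by simp
    ultimately show ?B by blast
  qed
  have iff: "j < d i \<longleftrightarrow> j < \<upsilon> * r \<and> (real i + 1) / real (\<upsilon> * s) + (real j + 1) / real (\<upsilon> * r) \<le> 1"
    if i: "i < \<upsilon> * s" for i j
  proof -
    have "j < d i \<longleftrightarrow> Suc j * s \<le> r * (\<upsilon> * s - 1 - i)"
      using d_special[OF assms i] less_eq_div_iff_mult_less_eq[of s "Suc j"] s_pos by (simp add: Suc_le_eq)
    also have "\<dots> \<longleftrightarrow> r * (i + 1) + s * (j + 1) \<le> r * (\<upsilon> * s)"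
    proof -
      have "\<upsilon> * s = (\<upsilon> * s - 1 - i) + (i + 1)" using i by simp
      then have "r * (\<upsilon> * s) = r * (\<upsilon> * s - 1 - i) + r * (i + 1)" by (metis distrib_left)
      then show ?thesis by (simp add: mult.commute)
    qed
    also have "\<dots> \<longleftrightarrow> real (r * (i + 1) + s * (j + 1)) \<le> real (r * (\<upsilon> * s))" by (simp only: of_nat_le_iff)
    also have "\<dots> \<longleftrightarrow> real (r * (i + 1) + s * (j + 1)) / real (r * (\<upsilon> * s)) \<le> 1"
      using N s_less by (simp add: divide_le_eq)
    also have "real (r * (i + 1) + s * (j + 1)) / real (r * (\<upsilon> * s))
        = (real i + 1) / real (\<upsilon> * s) + (real j + 1) / real (\<upsilon> * r)"
    proof -
      have "(real i + 1) / real (\<upsilon> * s) = real (r * (i + 1)) / real (r * (\<upsilon> * s))"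
        unfolding of_nat_mult of_nat_add of_nat_1 using s_less by simp
      moreover have "(real j + 1) / real (\<upsilon> * r) = real (s * (j + 1)) / real (s * (\<upsilon> * r))"
        unfolding of_nat_mult of_nat_add of_nat_1 using s_pos by simp
      moreover have "s * (\<upsilon> * r) = r * (\<upsilon> * s)" by (simp only: mult_ac)
      ultimately show ?thesis by (simp only: of_nat_add add_divide_distrib)
    qed
    finally have 1: "j < d i \<longleftrightarrow> (real i + 1) / real (\<upsilon> * s) + (real j + 1) / real (\<upsilon> * r) \<le> 1" .
    have "j < \<upsilon> * r" if "(real i + 1) / real (\<upsilon> * s) + (real j + 1) / real (\<upsilon> * r) \<le> 1"
    proof -
      have "0 < (real i + 1) / real (\<upsilon> * s)" using N by (intro divide_pos_pos) auto
      then have "(real j + 1) / real (\<upsilon> * r) \<le> 1" using that by linarith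
      then have "real j + 1 \<le> real (\<upsilon> * r)" using N by (simp add: divide_le_eq del: of_nat_mult)
      then show ?thesis by linarith
    qed
    then show ?thesis using 1 by blast
  qed
  show ?thesis
    unfolding boxes_above_diagonal_def box staircase_diagram_def using iff by auto
qed

end

section \<open>The ring of the curve as a module over the series in y\<close>

locale curve_over_field = curve +
  fixes field_type :: "'a::field itself"
  assumes s_nonzero: "of_nat s \<noteq> (0::'a)"
begin

abbreviation "xz \<equiv> param_x r \<upsilon> p :: 'a fps"
abbreviation "yz \<equiv> param_y s \<upsilon> :: 'a fps"
abbreviation "\<phi> \<equiv> proj_R r s \<upsilon> p :: 'a fps fps \<Rightarrow> 'a fps"
abbreviation "\<C> \<equiv> conductor_lift r s \<upsilon> p :: 'a fps fps set"

text \<open>At \<open>\<upsilon> * s\<close> the value is x times the previous one instead of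
  \<open>(x^s - y^r)^\<upsilon>\<close>. Both are \<open>x^(\<upsilon> s)\<close> modulo y, but this
  choice is a multiple of \<open>e (\<upsilon> * s - 1)\<close>.\<close>

definition e :: "nat \<Rightarrow> 'a fps fps" where
  "e m = (if m < \<upsilon> * s then varx ^ (m mod s) * (varx ^ s - vary ^ r) ^ (m div s)
     else varx * (varx ^ ((\<upsilon> * s - 1) mod s) * (varx ^ s - vary ^ r) ^ ((\<upsilon> * s - 1) div s)))"

definition E :: "nat \<Rightarrow> 'a fps" where
  "E m = xz ^ (m mod s) * (xz ^ s - yz ^ r) ^ (m div s)"

lemma xz_0: "xz $ 0 = 0" and yz_0: "yz $ 0 = 0"
  using \<upsilon>_pos s_pos s_less by (auto simp: param_x_def param_y_def)

lemma phi_add: "\<phi> (f + g) = \<phi> f + \<phi> g"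
  and phi_diff: "\<phi> (f - g) = \<phi> f - \<phi> g"
  and phi_mult: "\<phi> (f * g) = \<phi> f * \<phi> g"
  and phi_power: "\<phi> (f ^ n) = \<phi> f ^ n"
  and phi_sum: "\<phi> (\<Sum>k\<in>K. h k) = (\<Sum>k\<in>K. \<phi> (h k))"
  and phi_zero: "\<phi> 0 = 0"
  and phi_varx: "\<phi> varx = xz" and phi_vary: "\<phi> vary = yz"
  and phi_series_y: "\<phi> (series_y a) = a oo fps_X ^ (\<upsilon> * s)"
  using xz_0 yz_0
  by (simp_all add: proj_R_def subst_xy_add subst_xy_diff subst_xy_mult subst_xy_power subst_xy_sum
      subst_xy_varx subst_xy_vary subst_xy_series_y) (simp add: param_y_def)

lemma e_0: "m \<le> \<upsilon> * s \<Longrightarrow> e m $ 0 = fps_X ^ m"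
proof -
  have pow: "(varx ^ (m mod s) * (varx ^ s - vary ^ r) ^ (m div s) :: 'a fps fps) $ 0 = fps_X ^ m" for m
  proof -
    have "(varx ^ s - vary ^ r :: 'a fps fps) $ 0 = fps_X ^ s"
      using s_less by (simp add: varx_def vary_def fps_power_zeroth)
    then have "(varx ^ (m mod s) * (varx ^ s - vary ^ r) ^ (m div s) :: 'a fps fps) $ 0
        = fps_X ^ (m mod s) * (fps_X ^ s) ^ (m div s)"
      by (simp only: fps_mult_nth_0 fps_power_zeroth) (simp add: varx_def)
    also have "\<dots> = fps_X ^ (m mod s + s * (m div s))" by (simp only: power_add power_mult)
    finally show ?thesis by simp
  qed
  assume "m \<le> \<upsilon> * s"
  show ?thesis
  proof (cases "m < \<upsilon> * s")
    case True
    then show ?thesis by (simp only: e_def if_True pow)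
  next
    case False
    then have "m = Suc (\<upsilon> * s - 1)" using \<open>m \<le> \<upsilon> * s\<close> N_pos by simp
    moreover have "(varx :: 'a fps fps) $ 0 = fps_X" by (simp add: varx_def)
    moreover have "e m $ 0 = varx $ 0
        * (varx ^ ((\<upsilon> * s - 1) mod s) * (varx ^ s - vary ^ r) ^ ((\<upsilon> * s - 1) div s) :: 'a fps fps) $ 0"
      using False by (simp only: e_def if_False fps_mult_nth_0[of varx])
    ultimately show ?thesis by (simp only: pow power_Suc)
  qed
qed

lemma phi_e: "m < \<upsilon> * s \<Longrightarrow> \<phi> (e m) = E m"
  by (simp add: e_def E_def phi_mult phi_power phi_diff phi_varx phi_vary)

lemma e_last: "e (\<upsilon> * s) = varx * e (\<upsilon> * s - 1)"
  using N_pos by (simp add: e_def)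

lemma xz_eq: "xz = fps_X ^ (\<upsilon> * r) * (1 + fps_X ^ p)"
  by (simp add: param_x_def power_add distrib_left)

text \<open>
  With \<open>w = 1 + z\<^sup>p\<close> one has \<open>x\<^sup>s - y\<^sup>r = z\<^bsup>\<upsilon>rs\<^esup> (w\<^sup>s - 1)\<close> and
  \<open>w\<^sup>s - 1 = z\<^sup>p (1 + w + \<dots> + w\<^bsup>s-1\<^esup>)\<close>, where the last factor has constant term \<open>s \<noteq> 0\<close>.
\<close>

lemma E_eq_unit:
  shows "\<exists>u. u $ 0 \<noteq> 0 \<and> E m = fps_X ^ val m * u"
proof -
  define w where "w = (1 + fps_X ^ p :: 'a fps)"
  have w0: "w $ 0 = 1" using p_pos by (simp add: w_def)
  have xz_w: "xz = fps_X ^ (\<upsilon> * r) * w" unfolding w_def by (rule xz_eq)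
  have "xz ^ s = fps_X ^ (\<upsilon> * r * s) * w ^ s"
    unfolding xz_w power_mult_distrib by (simp only: power_mult)
  moreover have "yz ^ r = fps_X ^ (\<upsilon> * r * s)" by (simp add: param_y_def power_mult[symmetric] mult_ac)
  ultimately have "xz ^ s - yz ^ r = fps_X ^ (\<upsilon> * r * s) * (w ^ s - 1)"
    by (simp add: algebra_simps)
  also have "w ^ s - 1 = fps_X ^ p * (\<Sum>k<s. w ^ k)"
    unfolding power_diff_1_eq by (simp add: w_def)
  finally have diff: "xz ^ s - yz ^ r = fps_X ^ (\<upsilon> * r * s + p) * (\<Sum>k<s. w ^ k)"
    by (simp add: power_add mult.assoc)
  have "E m = xz ^ (m mod s) * (fps_X ^ (\<upsilon> * r * s + p) * (\<Sum>k<s. w ^ k)) ^ (m div s)"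
    unfolding E_def diff ..
  also have "\<dots> = (fps_X ^ (\<upsilon> * r)) ^ (m mod s) * (fps_X ^ (\<upsilon> * r * s + p)) ^ (m div s)
      * (w ^ (m mod s) * (\<Sum>k<s. w ^ k) ^ (m div s))"
    unfolding xz_w by (simp only: power_mult_distrib mult_ac)
  also have "(fps_X ^ (\<upsilon> * r)) ^ (m mod s) * (fps_X ^ (\<upsilon> * r * s + p)) ^ (m div s)
      = (fps_X ^ (\<upsilon> * r * (m mod s) + (\<upsilon> * r * s + p) * (m div s)) :: 'a fps)"
    by (simp only: power_mult[symmetric] power_add[symmetric])
  also have "\<upsilon> * r * (m mod s) + (\<upsilon> * r * s + p) * (m div s)
      = \<upsilon> * r * (m mod s + s * (m div s)) + p * (m div s)"
    by (simp only: distrib_left distrib_right add_ac mult_ac)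
  also have "\<dots> = val m" by (simp add: val_def)
  finally have "E m = fps_X ^ val m * (w ^ (m mod s) * (\<Sum>k<s. w ^ k) ^ (m div s))" .
  moreover have "(w ^ (m mod s) * (\<Sum>k<s. w ^ k) ^ (m div s)) $ 0 \<noteq> 0"
    using s_nonzero by (simp add: fps_power_zeroth fps_sum_nth w0)
  ultimately show ?thesis by blast
qed

sublocale apery_basis "\<upsilon> * s" val E
proof
  fix m
  obtain u where "u $ 0 \<noteq> 0" "E m = fps_X ^ val m * u" using E_eq_unit by blast
  then show "E m $ val m \<noteq> 0" "k < val m \<Longrightarrow> E m $ k = 0" for k
    by (simp_all add: fps_X_power_mult_nth)
qed

lemma phi_combination:
  "\<phi> (combination (\<upsilon> * s) e a h) = lincomb a + \<phi> h * (xz * E (\<upsilon> * s - 1))"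
proof -
  have "\<phi> (e (\<upsilon> * s)) = xz * E (\<upsilon> * s - 1)"
    using N_pos by (simp add: e_last phi_mult phi_varx phi_e)
  then show ?thesis
    by (simp add: combination_def lincomb_def phi_add phi_mult phi_sum phi_series_y phi_e)
qed

text \<open>The order of \<open>E (\<upsilon> * s - 1)\<close> is at least \<open>cond\<close>, so
  all its multiples lie in the conductor.\<close>

lemma last_below_cond: "k < cond \<Longrightarrow> (u * E (\<upsilon> * s - 1)) $ k = 0"
proof -
  assume "k < cond"
  then have "k < val (\<upsilon> * s - 1)" using N_pos unfolding cond_def by linarith
  then show ?thesis
    using N_pos E_below[of "\<upsilon> * s - 1"] by (intro fps_mult_nth_zero[of 0 u "val (\<upsilon> * s - 1)"]) auto
qed

text \<open>Division by \<open>e (\<upsilon> * s)\<close> maps to an element of \<open>M\<close>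
  plus a multiple of \<open>E (\<upsilon> * s - 1)\<close>, and the latter is in \<open>M\<close> as
  an element of the conductor.\<close>

lemma ring_R_eq_M: "ring_R r s \<upsilon> p = M"
proof
  show "ring_R r s \<upsilon> p \<subseteq> M"
  proof
    fix u assume "u \<in> (ring_R r s \<upsilon> p :: 'a fps set)"
    then obtain f where u: "u = \<phi> f" by (auto simp: ring_R_def)
    obtain a h where f: "f = combination (\<upsilon> * s) e a h"
      using combination_exists[of "\<upsilon> * s" e f] e_0 by blast
    have "(\<phi> h * xz) * E (\<upsilon> * s - 1) \<in> M" by (intro cond_in_M last_below_cond)
    moreover have "lincomb a \<in> M" by (simp add: M_def)
    ultimately show "u \<in> M" by (simp add: u f phi_combination M_add mult.assoc)
  qed
  show "M \<subseteq> ring_R r s \<upsilon> p"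
  proof
    fix u assume "u \<in> M"
    then obtain a where "u = lincomb a" by (auto simp: M_def)
    then have "u = \<phi> (combination (\<upsilon> * s) e a 0)" by (simp add: phi_combination phi_zero)
    then show "u \<in> ring_R r s \<upsilon> p" by (simp add: ring_R_def)
  qed
qed

lemma M_mult: "u \<in> M \<Longrightarrow> w \<in> M \<Longrightarrow> u * w \<in> M"
  unfolding ring_R_eq_M[symmetric] ring_R_def by (auto simp flip: phi_mult)

lemma E_zero: "E 0 = 1"
  by (simp add: E_def)

section \<open>Leading terms and generators of the lift of the conductor\<close>

lemma mem_conductor_lift: "f \<in> \<C> \<longleftrightarrow> (\<forall>k<cond. \<phi> f $ k = 0)"
  by (simp add: conductor_lift_def ring_R_eq_M conductor_M)

lemma ideal_of_conductor_lift: "ideal_of UNIV \<C>"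
proof -
  have "(u * w) $ k = 0" if "\<forall>k<cond. w $ k = 0" "k < cond" for u w :: "'a fps" and k
    using fps_mult_nth_zero[of 0 u cond w k] that by auto
  then show ?thesis
    by (auto simp: ideal_of_def mem_conductor_lift phi_zero phi_add phi_mult)
qed

lemma corner_series_in_conductor_lift:
  assumes "m < \<upsilon> * s"
  shows "vary ^ d m * e m \<in> \<C>"
proof -
  have "\<phi> (vary ^ d m * e m) = fps_X ^ (\<upsilon> * s * d m) * E m"
    using assms by (simp add: phi_mult phi_power phi_vary phi_e param_y_def power_mult)
  moreover have "cond \<le> val m + \<upsilon> * s * d m" using less_d_iff[OF assms, of "d m"] by simp
  ultimately show ?thesis using shift_E_nth(1)[OF assms] by (simp add: mem_conductor_lift)
qed

text \<open>The quotient term always maps into the conductor, so the remainder alone must vanish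
  below \<open>cond\<close>; then \<open>lincomb_vanish\<close> applies with
  \<open>less_d_iff\<close>.\<close>

lemma combination_in_conductor_lift:
  assumes "combination (\<upsilon> * s) e a h \<in> \<C>" "m < \<upsilon> * s" "k < d m"
  shows "a m $ k = 0"
proof (rule lincomb_vanish)
  fix l assume "l < cond"
  then have "(lincomb a + \<phi> h * (xz * E (\<upsilon> * s - 1))) $ l = 0"
    using assms(1) by (simp only: mem_conductor_lift phi_combination)
  then show "lincomb a $ l = 0"
    using last_below_cond[OF \<open>l < cond\<close>, of "\<phi> h * xz"] by (simp add: mult.assoc)
qed (use assms less_d_iff in auto)

lemma leading_not_in_diagram:
  assumes "f \<in> \<C>" "has_leading f m"
  shows "m \<notin> \<Lambda>"
proof (cases m)
  case (Pair i j)
  obtain a h where f: "f = combination (\<upsilon> * s) e a h"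
    using combination_exists[of "\<upsilon> * s" e f] e_0 by blast
  have "\<not> j < d i" if "i < \<upsilon> * s"
  proof -
    have "a i $ j \<noteq> 0"
      using combination_leading[of "\<upsilon> * s" e a h i j] e_0 assms(2) that Pair f by simp
    then show ?thesis using combination_in_conductor_lift assms(1) that f by blast
  qed
  then show ?thesis using Pair by (simp add: mem_diagram)
qed

lemma has_leading_corner_series:
  assumes "m < \<upsilon> * s"
  shows "has_leading (vary ^ j * e m) (m, j)"
  using assms e_0[of m] by (simp add: has_leading_iff coeff_vary_power_mult)

lemma leading_diagram_conductor_lift: "leading_diagram \<C> = \<Lambda>"
  using leading_not_in_diagram has_leading_corner_series corner_series_in_conductor_lift
  by (intro leading_diagram_eq) blast+

definition gen :: "nat \<times> nat \<Rightarrow> 'a fps fps" where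
  "gen c = vary ^ snd c * e (fst c)"

lemma has_leading_gen: "c \<in> outer_corners \<Lambda> \<Longrightarrow> has_leading (gen c) c"
  by (auto simp: outer_corners_diagram gen_def intro: has_leading_corner_series)

text \<open>Division writes an element of the lift through the \<open>e m\<close> with coefficients
  divisible by \<open>y^(d m)\<close>. The leftover multiple of \<open>e (\<upsilon> * s)\<close> is
  a multiple of the generator \<open>e (\<upsilon> * s - 1)\<close>.\<close>

lemma ideal_gen_gen: "ideal_gen (gen ` outer_corners \<Lambda>) = \<C>" (is "?G = _")
proof
  show "?G \<subseteq> \<C>"
    by (intro ideal_gen_minimal ideal_of_conductor_lift)
       (auto simp: outer_corners_diagram gen_def intro: corner_series_in_conductor_lift)
  have gens: "vary ^ d m * e m \<in> ?G" if "m < \<upsilon> * s" for m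
    by (rule subsetD[OF ideal_gen_superset])
       (use that in \<open>auto simp: outer_corners_diagram gen_def image_image\<close>)
  have last: "e (\<upsilon> * s) \<in> ?G"
    using ideal_of_mult_UNIV[OF ideal_of_ideal_gen gens, of "\<upsilon> * s - 1" varx] N_pos d_last
    by (simp add: e_last)
  show "\<C> \<subseteq> ?G"
  proof
    fix f assume f: "f \<in> \<C>"
    obtain a h where "f = combination (\<upsilon> * s) e a h"
      using combination_exists[of "\<upsilon> * s" e f] e_0 by blast
    then show "f \<in> ?G"
      using f combination_in_conductor_lift[of a h]
      by (auto intro!: combination_in_ideal[where d = d] ideal_of_ideal_gen gens last)
  qed
qed

text \<open>The reflection of \<open>b < s\<close> has quotient \<open>\<upsilon> - 1\<close> and
  remainder \<open>s - 1 - b\<close>.\<close>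

lemma gen_corner:
  assumes "b < s"
  shows "gen (\<upsilon> * s - 1 - b, r * b div s)
      = varx ^ (s - b - 1) * vary ^ (r * b div s) * (varx ^ s - vary ^ r) ^ (\<upsilon> - 1)"
proof -
  have b: "b < \<upsilon> * s" using assms \<upsilon>_pos by (metis less_le_trans mult_le_mono1 nat_mult_1)
  then show ?thesis
    using reflect_decomp[OF b] assms N_pos by (simp add: gen_def e_def mult_ac)
qed

lemma corner_in_outer_corners:
  assumes "b < s"
  shows "(\<upsilon> * s - 1 - b, r * b div s) \<in> outer_corners \<Lambda>"
  unfolding outer_corners_diagram using d_reflect[OF assms] N_pos by (intro image_eqI) auto

section \<open>The monomial cases\<close>

lemma corner_monom_in_conductor_lift:
  assumes special: "p = 1 \<or> \<upsilon> = 1" and m: "m < \<upsilon> * s"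
  shows "monom_xy (m, d m) \<in> \<C>"
proof -
  define b where "b = \<upsilon> * s - 1 - m"
  \<comment> \<open>Here \<open>d m\<close> is \<open>r * b div s\<close>, and a quotient plus one
    times the divisor exceeds the dividend.\<close>
  have "r * b < s * d m + s"
    unfolding d_special[OF assms] b_def[symmetric] using dividend_less_times_div[of s "r * b"] s_pos by simp
  then have "\<upsilon> * (r * b + 1) \<le> \<upsilon> * (s * d m + s)" by (intro mult_le_mono2) simp
  moreover have "val (\<upsilon> * s - 1) + 1 = \<upsilon> * r * m + \<upsilon> * (r * b + 1)"
  proof -
    have d0: "(\<upsilon> * s - 1) div s = \<upsilon> - 1" using reflect_decomp(1)[of 0] \<upsilon>_pos s_pos by simp
    \<comment> \<open>Both special cases enter only through this identity: \<open>p = 1\<close>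
      gives \<open>\<upsilon> - 1 + 1\<close>, and \<open>\<upsilon> = 1\<close> gives
      \<open>0 + 1\<close>.\<close>
    have 1: "p * (\<upsilon> - 1) + 1 = \<upsilon>" using special \<upsilon>_pos by auto
    have 2: "\<upsilon> * s - 1 = m + b" using m by (simp add: b_def)
    have "val (\<upsilon> * s - 1) + 1 = \<upsilon> * r * (m + b) + (p * (\<upsilon> - 1) + 1)"
      unfolding val_def 2 d0[unfolded 2] by (simp only: add.assoc)
    then show ?thesis unfolding 1 by (simp add: algebra_simps)
  qed
  ultimately have cond: "cond \<le> \<upsilon> * r * m + \<upsilon> * s * d m" by (simp add: cond_def algebra_simps)
  have "\<phi> (monom_xy (m, d m)) = fps_X ^ (\<upsilon> * r * m + \<upsilon> * s * d m) * (1 + fps_X ^ p) ^ m"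
    unfolding monom_xy.simps phi_mult phi_power phi_varx phi_vary xz_eq param_y_def
      power_mult_distrib power_mult power_add by (simp only: mult_ac)
  then show ?thesis using cond by (simp add: mem_conductor_lift fps_X_power_mult_nth)
qed

text \<open>The part \<open>g\<close> of \<open>f\<close> supported on \<open>\<Lambda>\<close>
  differs from \<open>f\<close> by an element of the diagram ideal, so it is in \<open>\<C>\<close>.
  If nonzero, it would have its leading monomial in \<open>\<Lambda>\<close>.\<close>

lemma conductor_lift_eq_diagram_ideal:
  assumes "p = 1 \<or> \<upsilon> = 1"
  shows "\<C> = diagram_ideal \<Lambda>"
proof
  show sub: "diagram_ideal \<Lambda> \<subseteq> \<C>"
    using assms by (intro diagram_ideal_subset ideal_of_conductor_lift corner_monom_in_conductor_lift)
  show "\<C> \<subseteq> diagram_ideal \<Lambda>"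
  proof
    fix f assume f: "f \<in> \<C>"
    define g where "g = Abs_fps (\<lambda>j. Abs_fps (\<lambda>i. if (i, j) \<in> \<Lambda> then f $ j $ i else 0))"
    have g_nth: "g $ j $ i = (if (i, j) \<in> \<Lambda> then f $ j $ i else 0)" for i j by (simp add: g_def)
    have "f - g \<in> \<C>" by (rule subsetD[OF sub]) (simp add: diagram_ideal_iff g_nth)
    then have "f - (f - g) \<in> \<C>" by (rule ideal_of_diff[OF ideal_of_conductor_lift f])
    then have "g \<in> \<C>" by simp
    have "g = 0"
    proof (rule ccontr)
      assume "g \<noteq> 0"
      then obtain m where m: "has_leading g m" using has_leading_exists by blast
      then have "m \<notin> \<Lambda>" using leading_not_in_diagram \<open>g \<in> \<C>\<close> by blast
      then show False using m by (cases m) (simp add: has_leading_iff g_nth)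
    qed
    then have "f $ j $ i = 0" if "(i, j) \<in> \<Lambda>" for i j using g_nth[of j i] that by simp
    then show "f \<in> diagram_ideal \<Lambda>" by (simp add: diagram_ideal_iff)
  qed
qed

end

section \<open>The statement for a given field\<close>

lemma curve_over_fieldI:
  assumes "s < r" "1 \<le> s" "1 \<le> \<upsilon>" "1 \<le> p" "coprime r s" "coprime \<upsilon> p"
    and char: "CHAR('a::field) = 0 \<or> coprime CHAR('a) s"
  shows "curve_over_field TYPE('a) r s \<upsilon> p"
proof
  show "of_nat s \<noteq> (0::'a)"
  proof
    assume "of_nat s = (0::'a)"
    then have dvd: "CHAR('a) dvd s" by (simp add: of_nat_eq_0_iff_char_dvd)
    \<comment> \<open>Characteristic 0 dividing \<open>s\<close> would force \<open>s = 0\<close>,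
      so the other alternative holds; it leaves characteristic 1, which no field has.\<close>
    then have "coprime CHAR('a) s" using char assms(2) by auto
    then have "CHAR('a) = 1" using dvd by (metis coprime_absorb_left nat_dvd_1_iff_1)
    then show False using of_nat_CHAR[where 'a = 'a] by simp
  qed
qed (use assms in auto)

theorem theorem7p2:
  fixes r s \<upsilon> :: nat
    and C :: "nat \<Rightarrow> 'a::field fps fps set"
    and R :: "nat \<Rightarrow> 'a fps set"
    and L :: "nat \<Rightarrow> (nat \<times> nat) set"
    and corner :: "nat \<Rightarrow> nat \<times> nat"
    and F :: "nat \<Rightarrow> 'a fps fps"
  assumes "r > s" "s \<ge> 1" "\<upsilon> \<ge> 1" "coprime r s"
    and "CHAR('a) = 0 \<or> coprime CHAR('a) s"
  defines "R \<equiv> \<lambda>p. ring_R r s \<upsilon> p"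
    and "C \<equiv> \<lambda>p. conductor_lift r s \<upsilon> p"
    and "L \<equiv> \<lambda>p. leading_diagram (C p)"
    and "corner \<equiv> \<lambda>b. (\<upsilon> * s - 1 - b, (r * b) div s)"
    and "F \<equiv> \<lambda>b. varx ^ (s - b - 1) * vary ^ ((r * b) div s) * (varx ^ s - vary ^ r) ^ (\<upsilon> - 1)"
  shows
    "(\<forall>p\<ge>1. coprime \<upsilon> p \<and> (p = 1 \<or> \<upsilon> = 1) \<longrightarrow>
        monomial_ideal (C p) \<and>
        C p = diagram_ideal (L p) \<and>
        L p = boxes_above_diagonal (\<upsilon> * s) (\<upsilon> * r) \<and>
        has_delta (R p) (card (L p)) \<and>
        monom_xy (hd (corner_list (L p))) = (varx ^ (\<upsilon> * s - 1) :: 'a fps fps) \<and>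
        monom_xy (last (corner_list (L p))) = (vary ^ (((\<upsilon> * s - 1) * r) div s) :: 'a fps fps) \<and>
        has_rank (diagram_ideal (L p) :: 'a fps fps set) (\<upsilon> * s) \<and>
        card (outer_corners (L p)) = \<upsilon> * s \<and>
        has_multiplicity (R p) (\<upsilon> * s))
     \<and>
     (\<forall>p\<ge>1. coprime \<upsilon> p \<longrightarrow>
        (\<forall>b<s. corner b \<in> outer_corners (L p)) \<and>
        (\<exists>g. (\<forall>c \<in> outer_corners (L p). has_leading (g c) c) \<and>
             ideal_gen (g ` outer_corners (L p)) = C p \<and>
             (\<forall>b<s. g (corner b) - F b \<in>
                ideal_gen (g ` {c \<in> outer_corners (L p). mon_less (corner b) c}))))
     \<and>
     (\<forall>i<(\<upsilon> - 1) * s.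
        filterlim (\<lambda>p. row_length (L p) i) at_top (inf at_top (principal {p. coprime \<upsilon> p})))"
proof (intro conjI)
  have curve: "curve_over_field TYPE('a) r s \<upsilon> p" if "1 \<le> p" "coprime \<upsilon> p" for p
    using assms(1-5) that by (intro curve_over_fieldI)
  show "\<forall>p\<ge>1. coprime \<upsilon> p \<and> (p = 1 \<or> \<upsilon> = 1) \<longrightarrow>
        monomial_ideal (C p) \<and>
        C p = diagram_ideal (L p) \<and>
        L p = boxes_above_diagonal (\<upsilon> * s) (\<upsilon> * r) \<and>
        has_delta (R p) (card (L p)) \<and>
        monom_xy (hd (corner_list (L p))) = (varx ^ (\<upsilon> * s - 1) :: 'a fps fps) \<and>
        monom_xy (last (corner_list (L p))) = (vary ^ (((\<upsilon> * s - 1) * r) div s) :: 'a fps fps) \<and>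
        has_rank (diagram_ideal (L p) :: 'a fps fps set) (\<upsilon> * s) \<and>
        card (outer_corners (L p)) = \<upsilon> * s \<and>
        has_multiplicity (R p) (\<upsilon> * s)"
  proof (intro allI impI)
    fix p :: nat
    assume p: "1 \<le> p" "coprime \<upsilon> p \<and> (p = 1 \<or> \<upsilon> = 1)"
    then interpret curve_over_field r s \<upsilon> p "TYPE('a)" using curve by blast
    have L: "L p = \<Lambda>" unfolding L_def C_def by (rule leading_diagram_conductor_lift)
    have C: "C p = diagram_ideal \<Lambda>" unfolding C_def using p by (intro conductor_lift_eq_diagram_ideal) blast
    have R: "R p = M" unfolding R_def by (rule ring_R_eq_M)
    have d0: "d 0 = (\<upsilon> * s - 1) * r div s"
      using p N_pos by (subst d_special) (auto simp: mult.commute)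
    have "monomial_ideal (C p)"
      unfolding monomial_ideal_def C diagram_ideal_eq_ideal_gen by blast
    moreover have "\<Lambda> = boxes_above_diagonal (\<upsilon> * s) (\<upsilon> * r)"
      using p by (intro diagram_eq_boxes) blast
    moreover have "monom_xy (hd (corner_list \<Lambda>)) = (varx ^ (\<upsilon> * s - 1) :: 'a fps fps)"
      by (simp add: hd_corner_list monom_xy.simps)
    moreover have "monom_xy (last (corner_list \<Lambda>)) = (vary ^ (((\<upsilon> * s - 1) * r) div s) :: 'a fps fps)"
      by (simp add: last_corner_list monom_xy.simps d0)
    ultimately show "monomial_ideal (C p) \<and>
        C p = diagram_ideal (L p) \<and>
        L p = boxes_above_diagonal (\<upsilon> * s) (\<upsilon> * r) \<and>
        has_delta (R p) (card (L p)) \<and>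
        monom_xy (hd (corner_list (L p))) = (varx ^ (\<upsilon> * s - 1) :: 'a fps fps) \<and>
        monom_xy (last (corner_list (L p))) = (vary ^ (((\<upsilon> * s - 1) * r) div s) :: 'a fps fps) \<and>
        has_rank (diagram_ideal (L p) :: 'a fps fps set) (\<upsilon> * s) \<and>
        card (outer_corners (L p)) = \<upsilon> * s \<and>
        has_multiplicity (R p) (\<upsilon> * s)"
      unfolding L R using C
      by (intro conjI has_delta_M has_rank_diagram_ideal card_outer_corners
          has_multiplicity_M[OF E_zero M_mult])
  qed
  show "\<forall>p\<ge>1. coprime \<upsilon> p \<longrightarrow>
        (\<forall>b<s. corner b \<in> outer_corners (L p)) \<and>
        (\<exists>g. (\<forall>c \<in> outer_corners (L p). has_leading (g c) c) \<and>
             ideal_gen (g ` outer_corners (L p)) = C p \<and>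
             (\<forall>b<s. g (corner b) - F b \<in>
                ideal_gen (g ` {c \<in> outer_corners (L p). mon_less (corner b) c})))"
  proof (intro allI impI)
    fix p :: nat
    assume p: "1 \<le> p" "coprime \<upsilon> p"
    then interpret curve_over_field r s \<upsilon> p "TYPE('a)" by (rule curve)
    have L: "L p = \<Lambda>" unfolding L_def C_def by (rule leading_diagram_conductor_lift)
    \<comment> \<open>At these corners the chosen generators equal \<open>F b\<close> exactly, so
      the difference lies in every ideal.\<close>
    have "gen (corner b) - F b = 0" if "b < s" for b
      using gen_corner[OF that] by (simp add: corner_def F_def)
    then have "gen (corner b) - F b \<in> ideal_gen (gen ` {c \<in> outer_corners \<Lambda>. mon_less (corner b) c})"
      if "b < s" for b
      using that ideal_of_zero[OF ideal_of_ideal_gen] by simp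
    moreover have "\<forall>b<s. corner b \<in> outer_corners \<Lambda>"
      unfolding corner_def using corner_in_outer_corners by blast
    ultimately show "(\<forall>b<s. corner b \<in> outer_corners (L p)) \<and>
        (\<exists>g. (\<forall>c \<in> outer_corners (L p). has_leading (g c) c) \<and>
             ideal_gen (g ` outer_corners (L p)) = C p \<and>
             (\<forall>b<s. g (corner b) - F b \<in>
                ideal_gen (g ` {c \<in> outer_corners (L p). mon_less (corner b) c})))"
      unfolding L using has_leading_gen ideal_gen_gen by (intro conjI exI[of _ gen]) (auto simp: C_def)
  qed
  show "\<forall>i<(\<upsilon> - 1) * s.
        filterlim (\<lambda>p. row_length (L p) i) at_top (inf at_top (principal {p. coprime \<upsilon> p}))"
  proof (intro allI impI)
    fix i assume i: "i < (\<upsilon> - 1) * s"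
    have bound: "p div (\<upsilon> * s) \<le> row_length (L p) i" if p: "1 \<le> p" "coprime \<upsilon> p" for p
    proof -
      interpret curve_over_field r s \<upsilon> p "TYPE('a)" using p by (rule curve)
      have L: "L p = \<Lambda>" unfolding L_def C_def by (rule leading_diagram_conductor_lift)
      have "i < \<upsilon> * s" using i by (simp add: diff_mult_distrib)
      then show ?thesis using p_div_le_d[OF i] by (simp add: L row_length_diagram)
    qed
    show "filterlim (\<lambda>p. row_length (L p) i) at_top (inf at_top (principal {p. coprime \<upsilon> p}))"
      unfolding filterlim_at_top eventually_inf_principal
    proof
      fix Z
      \<comment> \<open>The multiple of \<open>\<upsilon> * s\<close> makes the quotient of
        \<open>p\<close> at least \<open>Z\<close>; the added 1 ensures \<open>1 \<le> p\<close>
        also for \<open>Z = 0\<close>.\<close>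
      have "Z \<le> row_length (L p) i" if p: "p \<ge> Z * (\<upsilon> * s) + 1" "coprime \<upsilon> p" for p
      proof -
        have "Z \<le> p div (\<upsilon> * s)"
          using p assms(2,3) by (subst less_eq_div_iff_mult_less_eq) auto
        also have "\<dots> \<le> row_length (L p) i" using p by (intro bound) auto
        finally show ?thesis .
      qed
      then show "\<forall>\<^sub>F p in at_top. p \<in> {p. coprime \<upsilon> p} \<longrightarrow> Z \<le> row_length (L p) i"
        unfolding eventually_at_top_linorder by blast
    qed
  qed
qed

end
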